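(* Given an unweighted graph $G$ on $n$ vertices and a parameter $r\in\{1,2,\ldots,\log n\}$, it is possible to find a minimum cut of $G$ using $\tilde{O}(r n^{1+1/r})$ cut queries in $3r+4$ rounds. The algorithm is randomized and succeeds with probability $1-n^{-2}$.
   Context: Cut-query model: the graph $G=(V,E)$, $n=|V|$, is accessed only via queries returning $\mathrm{cut}_G(S)$, the number of edges with exactly one endpoint in $S$, for a given $S\subseteq V$. An algorithm has round complexity $r$ if its queries are issued in $r$ rounds, queries of round $t$ depending only on answers from earlier rounds. Finding a minimum cut means outputting $\emptyset\ne S\subsetneq V$ minimizing $\mathrm{cut}_G(S)$ and its value. $\tilde{O}(\cdot)$ hides polylogarithmic factors in $n$. *)

theory Defs
  imports "HOL-Probability.Probability_Mass_Function"
begin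

definition simple_graph :: "'a set \<Rightarrow> 'a set set \<Rightarrow> bool" where
  "simple_graph V E \<longleftrightarrow> finite V \<and> (\<forall>e\<in>E. e \<subseteq> V \<and> card e = 2)"

definition cut_size :: "'a set set \<Rightarrow> 'a set \<Rightarrow> nat" where
  "cut_size E S = card {e \<in> E. card (e \<inter> S) = 1}"

definition is_min_cut :: "'a set \<Rightarrow> 'a set set \<Rightarrow> 'a set \<Rightarrow> bool" where
  "is_min_cut V E S \<longleftrightarrow> S \<noteq> {} \<and> S \<subset> V \<and>
     (\<forall>T. T \<noteq> {} \<and> T \<subset> V \<longrightarrow> cut_size E S \<le> cut_size E T)"

text \<open>A deterministic algorithm either stops, returning a vertex set and a value, or issues a
  whole round of queries at once and continues depending on the list of their answers. Hence
  the queries of a round depend only on answers from earlier rounds. A randomized algorithm is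
  a probability distribution over deterministic ones (all coins are drawn in advance).\<close>

datatype 'a cut_alg =
    Output "'a set" nat
  | Round "'a set list" "nat list \<Rightarrow> 'a cut_alg"

primrec alg_output :: "('a set \<Rightarrow> nat) \<Rightarrow> 'a cut_alg \<Rightarrow> 'a set \<times> nat" where
  "alg_output oracl (Output S v) = (S, v)"
| "alg_output oracl (Round Qs next) = alg_output oracl (next (map oracl Qs))"

primrec queries_by_round :: "('a set \<Rightarrow> nat) \<Rightarrow> 'a cut_alg \<Rightarrow> 'a set list list" where
  "queries_by_round oracl (Output S v) = []"
| "queries_by_round oracl (Round Qs next) = Qs # queries_by_round oracl (next (map oracl Qs))"

definition num_rounds :: "'a set set \<Rightarrow> 'a cut_alg \<Rightarrow> nat" where
  "num_rounds E A = length (queries_by_round (cut_size E) A)"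

definition num_queries :: "'a set set \<Rightarrow> 'a cut_alg \<Rightarrow> nat" where
  "num_queries E A = length (concat (queries_by_round (cut_size E) A))"

definition legal_queries :: "'a set \<Rightarrow> 'a set set \<Rightarrow> 'a cut_alg \<Rightarrow> bool" where
  "legal_queries V E A \<longleftrightarrow>
     (\<forall>S \<in> set (concat (queries_by_round (cut_size E) A)). S \<subseteq> V)"

definition finds_min_cut :: "'a set \<Rightarrow> 'a set set \<Rightarrow> 'a cut_alg \<Rightarrow> bool" where
  "finds_min_cut V E A \<longleftrightarrow>
     (\<exists>S. alg_output (cut_size E) A = (S, cut_size E S) \<and> is_min_cut V E S)"

end

theory Submission
  imports Defs "HOL-Probability.Product_PMF"
begin

text \<open>
  If no single vertex gives a minimum cut, fix a minimum cut; its value is below the minimum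
  degree \<open>\<delta>\<close>. Every vertex picks a random neighbour among about \<open>n log n / \<delta>\<close> random centers, and
  vertices with the same pick are identified. With constant probability no vertex picks across
  the cut: at most half of the edges at any vertex cross it, and the crossing fractions of the
  vertices sum to at most 2. This leaves \<open>n' = O(n log n / \<delta>)\<close> classes.

  Then the edges between classes are sampled at rates \<open>n powr (j / r - 1)\<close> for \<open>j = 1, \<dots>, r\<close>. At each
  level, classes are merged until fewer than \<open>k n'\<close> sampled edges cross, while no set with fewer
  than \<open>k\<close> crossing samples is destroyed, where \<open>k = O(log n + \<delta> rate)\<close>. A union bound over all
  \<open>n powr n'\<close> coarsenings shows that few edges, sampled or not, cross the new classes, so that the
  next sample, whose rate is larger by a factor \<open>n powr (1 / r)\<close>, still has only about
  \<open>n powr (1 + 1 / r)\<close> edges; at the last level all remaining edges are known.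

  A set of at most \<open>x\<close> neighbours is recovered in a single round from \<open>O(x log n)\<close> counts, since a
  counting argument gives that many subsets of the vertices separating all pairs of such sets.
  There are two rounds per level, and logarithmically many trials run in parallel.
\<close>

section \<open>Protocols given by causal query functions\<close>

text \<open>The quantity to control is \<delta> \<open>n'\<close> = O(n log n). A minimum cut may
  have about \<delta> edges, so \<open>k\<close> has to grow with \<delta> times the rate, and only
  this product bound keeps \<open>k n'\<close> at O(n log n) at every rate. Then
  O(\<open>k n'\<close> / rate) edges survive a level.

  If every center were visible to every vertex, a vertex of degree far above \<delta> would have too
  many neighbouring centers to recover. So a vertex uses only centers whose hash value lies below a
  threshold inversely proportional to its degree. These center sets are nested, and the number of
  classes is still governed by the threshold for \<delta>.

  The labels reached at a level depend on the very sample to be analysed. Only the star labels are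
  independent of all samples, hence the union bound over all their coarsenings; it is affordable
  because a single coarsening with many crossing edges gets too few samples with probability at most
  \<open>2 powr (- k * n')\<close>, where \<open>k\<close> is at least logarithmic.

  As all coins are drawn in advance, there is a pick for every conceivable center set and a sampling
  coin for every pair of vertices.\<close>

definition update_oracle :: "('a set \<Rightarrow> nat) \<Rightarrow> 'a set list \<Rightarrow> nat list \<Rightarrow> 'a set \<Rightarrow> nat" where
  "update_oracle c Qs as S = (case map_of (zip Qs as) S of Some a \<Rightarrow> a | None \<Rightarrow> c S)"

text \<open>The argument \<open>c\<close> is the table of answers so far, completed to a total
  oracle by arbitrary defaults. A protocol can thus be written as if the whole cut function were at
  hand; causality, proved separately, ensures that the defaults do not influence the run.\<close>

primrec protocol_alg ::
  "(nat \<Rightarrow> ('a set \<Rightarrow> nat) \<Rightarrow> 'a set list) \<Rightarrow> (('a set \<Rightarrow> nat) \<Rightarrow> 'a set \<times> nat) \<Rightarrow>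
   nat \<Rightarrow> nat \<Rightarrow> ('a set \<Rightarrow> nat) \<Rightarrow> 'a cut_alg" where
  "protocol_alg Qs out 0 t c = Output (fst (out c)) (snd (out c))"
| "protocol_alg Qs out (Suc m) t c =
     Round (Qs t c) (\<lambda>as. protocol_alg Qs out m (Suc t) (update_oracle c (Qs t c) as))"

definition agree :: "(nat \<Rightarrow> ('a set \<Rightarrow> nat) \<Rightarrow> 'a set list) \<Rightarrow> nat \<Rightarrow> ('a set \<Rightarrow> nat) \<Rightarrow> ('a set \<Rightarrow> nat) \<Rightarrow> bool" where
  "agree Qs t c c' \<longleftrightarrow> (\<forall>i<t. \<forall>S\<in>set (Qs i c). c S = c' S)"

definition causal :: "(nat \<Rightarrow> ('a set \<Rightarrow> nat) \<Rightarrow> 'a set list) \<Rightarrow> nat \<Rightarrow> (('a set \<Rightarrow> nat) \<Rightarrow> 'b) \<Rightarrow> bool" where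
  "causal Qs t f \<longleftrightarrow> (\<forall>c c'. agree Qs t c c' \<longrightarrow> f c = f c')"

lemma causalD: "causal Qs t f \<Longrightarrow> agree Qs t c c' \<Longrightarrow> f c = f c'"
  by (auto simp: causal_def)

lemma update_oracle_answers:
  "update_oracle c' Qs (map c Qs) S = (if S \<in> set Qs then c S else c' S)"
proof -
  have "map_of (zip Qs (map c Qs)) S = (if S \<in> set Qs then Some (c S) else None)"
    by (induction Qs) auto
  then show ?thesis by (simp add: update_oracle_def)
qed

text \<open>Invariant: the table \<open>c'\<close> agrees with the true oracle \<open>c\<close> on
  all queries of rounds before \<open>t\<close>. By causality both then yield the same queries for
  round \<open>t\<close>, and entering their answers restores the invariant.\<close>

lemma protocol_alg_correct:
  assumes "\<And>t. t < R \<Longrightarrow> causal Qs t (Qs t)" and "causal Qs R out"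
    and "t + m = R" and "agree Qs t c c'"
  shows "queries_by_round c (protocol_alg Qs out m t c') = map (\<lambda>i. Qs i c) [t..<R] \<and>
    alg_output c (protocol_alg Qs out m t c') = out c"
  using assms(3,4)
proof (induction m arbitrary: t c')
  case 0
  then have "out c' = out c" using causalD[OF assms(2)] by auto
  with 0 show ?case by simp
next
  case (Suc m)
  have eq: "Qs t c' = Qs t c"
    using causalD[OF assms(1) Suc.prems(2)] Suc.prems(1) by simp
  have "agree Qs (Suc t) c (update_oracle c' (Qs t c) (map c (Qs t c)))"
    using Suc.prems(2) by (auto simp: agree_def update_oracle_answers less_Suc_eq)
  from Suc.IH[OF _ this] Suc.prems(1) show ?case
    by (simp add: eq upt_conv_Cons)
qed

section \<open>Separating families\<close>

text \<open>Toggling an element \<open>u\<close> that lies in exactly one of \<open>X\<close> and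
  \<open>Y\<close> changes exactly one of the two counts, so it maps the non-separating sets
  injectively to separating ones.\<close>

lemma card_unseparating_le:
  assumes V: "finite V" and "X \<subseteq> V" "Y \<subseteq> V" "X \<noteq> Y"
  shows "2 * card {W \<in> Pow V. card (X \<inter> W) = card (Y \<inter> W)} \<le> 2 ^ card V"
proof -
  obtain u where u: "u \<in> V" "u \<in> X \<longleftrightarrow> u \<notin> Y" using assms by blast
  define U where "U = {W \<in> Pow V. card (X \<inter> W) = card (Y \<inter> W)}"
  define t where "t = (\<lambda>W. if u \<in> W then W - {u} else insert u W)"
  have fin: "finite X" "finite Y" using assms finite_subset by auto
  have tt: "t (t W) = W" for W by (auto simp: t_def)
  have inj: "inj_on t U" by (metis inj_onI tt)
  have ins: "card (Z \<inter> insert u W) = (if u \<in> Z then Suc (card (Z \<inter> W)) else card (Z \<inter> W))"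
    if "finite Z" "u \<notin> W" for Z W using that by simp
  have step: "card (X \<inter> W) = card (Y \<inter> W) \<Longrightarrow> card (X \<inter> insert u W) \<noteq> card (Y \<inter> insert u W)"
    if "u \<notin> W" for W using ins[OF fin(1) that] ins[OF fin(2) that] u(2) by (auto split: if_splits)
  have disj: "U \<inter> t ` U = {}"
  proof -
    { fix W assume W: "W \<in> U" "t W \<in> U"
      have False
      proof (cases "u \<in> W")
        case True
        then have "insert u (W - {u}) = W" by auto
        then show False using step[of "W - {u}"] W True by (auto simp: U_def t_def)
      next
        case False
        then show False using step[of W] W by (auto simp: U_def t_def)
      qed }
    then show ?thesis by auto
  qed
  have sub: "U \<union> t ` U \<subseteq> Pow V" using u(1) by (auto simp: U_def t_def)
  have finU: "finite U" using V by (auto simp: U_def)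
  have "2 * card U = card (U \<union> t ` U)"
    using card_Un_disjoint[OF finU _ disj] finU card_image[OF inj] by simp
  also have "\<dots> \<le> card (Pow V)" using V sub by (intro card_mono) auto
  finally show ?thesis by (simp add: U_def card_Pow V)
qed

text \<open>Greedy halving: by averaging, some \<open>W\<close> separates at least half of the pairs
  in \<open>B\<close>, and the induction hypothesis treats the rest. The strict bound makes
  \<open>B\<close> empty when \<open>m\<close> is 0.\<close>

lemma separating_list_exists:
  assumes V: "finite V"
  shows "finite B \<Longrightarrow> card B < 2 ^ m \<Longrightarrow> \<forall>(X, Y)\<in>B. X \<subseteq> V \<and> Y \<subseteq> V \<and> X \<noteq> Y \<Longrightarrow>
    \<exists>Ws. length Ws \<le> m \<and> set Ws \<subseteq> Pow V \<and> (\<forall>(X, Y)\<in>B. \<exists>W\<in>set Ws. card (X \<inter> W) \<noteq> card (Y \<inter> W))"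
proof (induction m arbitrary: B)
  case 0
  then have "B = {}" by simp
  then show ?case by (intro exI[of _ "[]"]) auto
next
  case (Suc m)
  define R where "R = (\<lambda>W. {(X, Y) \<in> B. card (X \<inter> W) = card (Y \<inter> W)})"
  have "\<exists>W\<in>Pow V. 2 * card (R W) \<le> card B"
  proof (rule ccontr)
    assume "\<not> ?thesis"
    then have gt: "\<And>W. W \<in> Pow V \<Longrightarrow> card B < 2 * card (R W)" by (meson not_le)
    \<comment> \<open>Double counting of the incidences between a set and a pair that it fails to
      separate.\<close>
    have swap: "(\<Sum>W\<in>Pow V. card (R W)) = (\<Sum>b\<in>B. card {W \<in> Pow V. card (fst b \<inter> W) = card (snd b \<inter> W)})"
    proof -
      have "(\<Sum>W\<in>Pow V. card (R W)) = (\<Sum>W\<in>Pow V. \<Sum>b\<in>B. if card (fst b \<inter> W) = card (snd b \<inter> W) then 1 else 0)"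
      proof (intro sum.cong refl)
        fix W
        have "R W = {b \<in> B. card (fst b \<inter> W) = card (snd b \<inter> W)}" by (auto simp: R_def)
        then show "card (R W) = (\<Sum>b\<in>B. if card (fst b \<inter> W) = card (snd b \<inter> W) then 1 else 0)"
          using Suc.prems(1) by (simp add: sum.If_cases Int_def)
      qed
      also have "\<dots> = (\<Sum>b\<in>B. \<Sum>W\<in>Pow V. if card (fst b \<inter> W) = card (snd b \<inter> W) then 1 else 0)"
        by (rule sum.swap)
      also have "\<dots> = (\<Sum>b\<in>B. card {W \<in> Pow V. card (fst b \<inter> W) = card (snd b \<inter> W)})"
        using V by (intro sum.cong refl) (simp add: sum.If_cases Int_def)
      finally show ?thesis .
    qed
    have "2 ^ card V * card B = (\<Sum>W\<in>Pow V. card B)" by (simp add: card_Pow V)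
    also have "\<dots> < (\<Sum>W\<in>Pow V. 2 * card (R W))"
      using V gt by (intro sum_strict_mono) auto
    also have "\<dots> = (\<Sum>b\<in>B. 2 * card {W \<in> Pow V. card (fst b \<inter> W) = card (snd b \<inter> W)})"
      by (simp add: sum_distrib_left[symmetric] swap)
    also have "\<dots> \<le> (\<Sum>b\<in>B. 2 ^ card V)"
    proof (intro sum_mono)
      fix b assume "b \<in> B"
      then have "fst b \<subseteq> V \<and> snd b \<subseteq> V \<and> fst b \<noteq> snd b" using Suc.prems(3) by (cases b) auto
      then show "2 * card {W \<in> Pow V. card (fst b \<inter> W) = card (snd b \<inter> W)} \<le> 2 ^ card V"
        using card_unseparating_le[OF V] by blast
    qed
    finally show False by simp
  qed
  then obtain W where W: "W \<subseteq> V" "2 * card (R W) \<le> card B" by auto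
  have sub: "R W \<subseteq> B" by (auto simp: R_def)
  have "finite (R W)" using sub Suc.prems(1) finite_subset by blast
  moreover have "card (R W) < 2 ^ m" using W(2) Suc.prems(2) by simp
  moreover have "\<forall>(X, Y)\<in>R W. X \<subseteq> V \<and> Y \<subseteq> V \<and> X \<noteq> Y" using sub Suc.prems(3) by blast
  ultimately obtain Ws where Ws: "length Ws \<le> m" "set Ws \<subseteq> Pow V"
      "\<forall>(X, Y)\<in>R W. \<exists>W\<in>set Ws. card (X \<inter> W) \<noteq> card (Y \<inter> W)"
    using Suc.IH[of "R W"] by blast
  show ?case
  proof (intro exI[of _ "W # Ws"] conjI)
    show "\<forall>(X, Y)\<in>B. \<exists>W\<in>set (W # Ws). card (X \<inter> W) \<noteq> card (Y \<inter> W)"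
      using Ws(3) by (fastforce simp: R_def)
  qed (use W Ws in auto)
qed

text \<open>A nonempty set is the range of a list of length exactly \<open>x\<close>, padded by
  repeating one element; the extra 1 pays for the empty set.\<close>

lemma card_small_subsets_le:
  assumes "finite V"
  shows "finite {Y. Y \<subseteq> V \<and> card Y \<le> x}" "card {Y. Y \<subseteq> V \<and> card Y \<le> x} \<le> card V ^ x + 1"
proof -
  show "finite {Y. Y \<subseteq> V \<and> card Y \<le> x}" using assms by auto
  define A where "A = {xs. set xs \<subseteq> V \<and> length xs = x}"
  have finA: "finite A" unfolding A_def using finite_lists_length_eq[OF assms] .
  have "{Y. Y \<subseteq> V \<and> card Y \<le> x} \<subseteq> insert {} (set ` A)"
  proof (intro subsetI)
    fix Y assume Y: "Y \<in> {Y. Y \<subseteq> V \<and> card Y \<le> x}"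
    show "Y \<in> insert {} (set ` A)"
    proof (cases "Y = {}")
      case False
      then obtain y where y: "y \<in> Y" by auto
      obtain ys where ys: "set ys = Y" "distinct ys"
        using Y assms finite_distinct_list finite_subset by (metis (mono_tags) mem_Collect_eq)
      have "length ys \<le> x" using Y ys distinct_card by fastforce
      then have "set (ys @ replicate (x - length ys) y) = Y" "length (ys @ replicate (x - length ys) y) = x"
        using ys y by (auto simp: set_replicate_conv_if)
      then show ?thesis using Y unfolding A_def by blast
    qed auto
  qed
  then have "card {Y. Y \<subseteq> V \<and> card Y \<le> x} \<le> card (insert {} (set ` A))"
    using finA by (intro card_mono) auto
  also have "\<dots> \<le> card (set ` A) + 1" by (simp add: card_insert_le_m1 card_insert_if finA)
  also have "\<dots> \<le> card A + 1" using card_image_le[OF finA] by simp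
  also have "card A = card V ^ x" unfolding A_def using card_lists_length_eq[OF assms] .
  finally show "card {Y. Y \<subseteq> V \<and> card Y \<le> x} \<le> card V ^ x + 1" .
qed

text \<open>There are at most \<open>2 ^ (2 * L * x + 2)\<close> ordered pairs of such sets, and one
  more halving removes the last of them. The length is proportional to \<open>x\<close>, which is
  what makes recovering a small neighbourhood cheap.\<close>

lemma small_set_separating_list_exists:
  assumes V: "finite V" and L: "card V \<le> 2 ^ L"
  shows "\<exists>Ws. length Ws \<le> 2 * L * x + 3 \<and> set Ws \<subseteq> Pow V \<and>
    (\<forall>X Y. X \<subseteq> V \<and> Y \<subseteq> V \<and> card X \<le> x \<and> card Y \<le> x \<and> X \<noteq> Y \<longrightarrow>
       (\<exists>W\<in>set Ws. card (X \<inter> W) \<noteq> card (Y \<inter> W)))"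
proof -
  define A where "A = {Y. Y \<subseteq> V \<and> card Y \<le> x}"
  define B where "B = {(X, Y) \<in> A \<times> A. X \<noteq> Y}"
  have A: "finite A" "card A \<le> card V ^ x + 1" unfolding A_def using card_small_subsets_le[OF V] by auto
  have "card V ^ x \<le> 2 ^ (L * x)" using power_mono[OF L, of x] by (simp add: power_mult)
  then have cA: "card A \<le> 2 * 2 ^ (L * x)" using A(2) one_le_power[of "2::nat" "L * x"] by linarith
  have "card B \<le> card (A \<times> A)" unfolding B_def using A by (intro card_mono) auto
  also have "\<dots> = card A * card A" by (simp add: card_cartesian_product)
  also have "\<dots> \<le> (2 * 2 ^ (L * x)) * (2 * 2 ^ (L * x))" using cA by (intro mult_mono) auto
  also have "\<dots> = 2 ^ (1 + L * x) * 2 ^ (1 + L * x)" by simp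
  also have "\<dots> = 2 ^ (2 * L * x + 2)"
    unfolding power_add[symmetric] by (rule arg_cong[of _ _ "\<lambda>m. 2 ^ m"]) simp
  also have "\<dots> < 2 ^ (2 * L * x + 3)" by (rule power_strict_increasing) simp_all
  finally have cB: "card B < 2 ^ (2 * L * x + 3)" .
  have "finite B" unfolding B_def using A by (auto intro: finite_subset[of _ "A \<times> A"])
  moreover have "\<forall>(X, Y)\<in>B. X \<subseteq> V \<and> Y \<subseteq> V \<and> X \<noteq> Y" by (simp add: B_def A_def)
  ultimately obtain Ws where Ws: "length Ws \<le> 2 * L * x + 3" "set Ws \<subseteq> Pow V"
    "\<forall>(X, Y)\<in>B. \<exists>W\<in>set Ws. card (X \<inter> W) \<noteq> card (Y \<inter> W)"
    using separating_list_exists[OF V _ cB] by blast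
  have "\<exists>W\<in>set Ws. card (X \<inter> W) \<noteq> card (Y \<inter> W)"
    if "X \<subseteq> V" "Y \<subseteq> V" "card X \<le> x" "card Y \<le> x" "X \<noteq> Y" for X Y
  proof -
    have "(X, Y) \<in> B" using that by (simp add: B_def A_def)
    then show ?thesis using Ws(3) by blast
  qed
  with Ws show ?thesis by blast
qed

section \<open>Coarsening a labeling\<close>

definition crossing :: "('a \<Rightarrow> 'b) \<Rightarrow> ('a \<times> 'a) set \<Rightarrow> ('a \<times> 'a) set" where
  "crossing f A = {(u, v) \<in> A. f u \<noteq> f v}"

text \<open>Membership predicates serve as two-valued labelings:
  \<open>coarser V f (\<lambda>v. v \<in> S)\<close> expresses that \<open>S\<close> is, within
  \<open>V\<close>, a union of classes of \<open>f\<close>.\<close>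

definition coarser :: "'a set \<Rightarrow> ('a \<Rightarrow> 'b) \<Rightarrow> ('a \<Rightarrow> 'c) \<Rightarrow> bool" where
  "coarser V f g \<longleftrightarrow> (\<forall>u\<in>V. \<forall>v\<in>V. f u = f v \<longrightarrow> g u = g v)"

lemma coarser_trans: "coarser V f g \<Longrightarrow> coarser V g h \<Longrightarrow> coarser V f h"
  unfolding coarser_def by blast

lemma coarser_refl: "coarser V f f"
  unfolding coarser_def by blast

text \<open>Take as many classes as the counting bound permits. If some class met both
  \<open>S\<close> and its complement, cutting it along \<open>S\<close> would add one class and
  fewer than \<open>k\<close> crossing pairs, so the bound would survive, against
  maximality.\<close>

lemma coarsening_exists:
  fixes f0 :: "'a \<Rightarrow> 'b"
  assumes V: "finite V" "V \<noteq> {}" and A: "A \<subseteq> V \<times> V"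
  shows "\<exists>f :: 'a \<Rightarrow> 'a. f ` V \<subseteq> V \<and> coarser V f0 f \<and> card (crossing f A) + k \<le> k * card (f ` V) \<and>
    (\<forall>S. coarser V f0 (\<lambda>v. v \<in> S) \<and> card (crossing (\<lambda>v. v \<in> S) A) < k \<longrightarrow> coarser V f (\<lambda>v. v \<in> S))"
proof -
  define P where "P = (\<lambda>f :: 'a \<Rightarrow> 'a. f ` V \<subseteq> V \<and> coarser V f0 f \<and> card (crossing f A) + k \<le> k * card (f ` V))"
  obtain v0 where v0: "v0 \<in> V" using V by auto
  \<comment> \<open>With a single class nothing crosses, and the bound reads
    \<open>k \<le> k\<close>.\<close>
  have "P (\<lambda>_. v0)" using v0 V unfolding P_def coarser_def crossing_def
    by (auto simp: image_constant_conv)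
  moreover have "\<forall>f. P f \<longrightarrow> card (f ` V) < Suc (card V)" by (simp add: less_Suc_eq_le card_image_le[OF V(1)])
  ultimately obtain f where f: "P f" and fmax: "\<And>g. P g \<Longrightarrow> card (g ` V) \<le> card (f ` V)"
    using ex_has_greatest_nat[of P _ "\<lambda>f. card (f ` V)"] by blast
  have finA: "finite A" using A V(1) finite_subset by blast
  have "coarser V f (\<lambda>v. v \<in> S)"
    if S: "coarser V f0 (\<lambda>v. v \<in> S)" "card (crossing (\<lambda>v. v \<in> S) A) < k" for S
  proof (rule ccontr)
    assume "\<not> ?thesis"
    then obtain u v where uv: "u \<in> V" "v \<in> V" "f u = f v" "u \<in> S" "v \<notin> S"
      unfolding coarser_def by metis
    \<comment> \<open>The new class needs a label in \<open>V\<close>; since two vertices share a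
      label, one is still free.\<close>
    have "\<not> inj_on f V" using uv by (auto simp: inj_on_def)
    then have "card (f ` V) < card V" using V(1) by (meson card_image_le eq_card_imp_inj_on le_neq_implies_less)
    moreover have "f ` V \<subseteq> V" using f by (simp add: P_def)
    ultimately obtain w where w: "w \<in> V" "w \<notin> f ` V" by (metis less_irrefl subsetI subset_antisym)
    define f' where "f' = (\<lambda>x. if f x = f u \<and> x \<in> S then w else f x)"
    have im: "f' ` V = insert w (f ` V)"
    proof
      show "f' ` V \<subseteq> insert w (f ` V)" by (auto simp: f'_def)
      have "w = f' u" using uv by (simp add: f'_def)
      moreover have "f x \<in> f' ` V" if "x \<in> V" for x
      proof (cases "f x = f u")
        case True
        then have "f x = f' v" using uv by (simp add: f'_def)
        then show ?thesis using uv by auto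
      next
        case False
        then have "f x = f' x" by (simp add: f'_def)
        then show ?thesis using that by auto
      qed
      ultimately show "insert w (f ` V) \<subseteq> f' ` V" using uv by auto
    qed
    then have card': "card (f' ` V) = Suc (card (f ` V))" using w V(1) by simp
    have sub: "crossing f' A \<subseteq> crossing f A \<union> crossing (\<lambda>v. v \<in> S) A"
      by (auto simp: crossing_def f'_def split: if_splits)
    have fin2: "finite (crossing f A \<union> crossing (\<lambda>v. v \<in> S) A)"
      using finA by (auto simp: crossing_def intro: finite_subset[of _ A])
    have "card (crossing f' A) \<le> card (crossing f A) + card (crossing (\<lambda>v. v \<in> S) A)"
      using card_mono[OF fin2 sub] card_Un_le[of "crossing f A" "crossing (\<lambda>v. v \<in> S) A"] by linarith
    moreover have "card (crossing f A) + k \<le> k * card (f ` V)" using f by (simp add: P_def)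
    ultimately have "card (crossing f' A) + k \<le> k * card (f' ` V)" using S(2) card' by simp
    moreover have "coarser V f0 f'" using f S(1) unfolding P_def coarser_def f'_def by metis
    moreover have "f' ` V \<subseteq> V" using im w f by (auto simp: P_def)
    ultimately have "P f'" by (simp add: P_def)
    then show False using fmax card' by fastforce
  qed
  with f show ?thesis unfolding P_def by blast
qed

section \<open>Cuts and neighbourhoods\<close>

definition nbrs :: "'a set set \<Rightarrow> 'a \<Rightarrow> 'a set" where
  "nbrs E v = {u. u \<noteq> v \<and> {v, u} \<in> E}"

text \<open>Every edge gives two arcs, so that counts can be summed vertex by vertex. Crossing
  counts are therefore twice the cut sizes, and the two directions of an edge get separate sampling
  coins.\<close>

definition edge_arcs :: "'a set set \<Rightarrow> ('a \<times> 'a) set" where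
  "edge_arcs E = {(v, u). u \<in> nbrs E v}"

lemma nbrs_sym: "u \<in> nbrs E v \<longleftrightarrow> v \<in> nbrs E u"
  by (auto simp: nbrs_def insert_commute)

lemma nbrs_subset: "simple_graph V E \<Longrightarrow> nbrs E v \<subseteq> V"
  by (auto simp: nbrs_def simple_graph_def)

lemma not_self_nbr: "v \<notin> nbrs E v"
  by (simp add: nbrs_def)

lemma edge_arcs_subset: "simple_graph V E \<Longrightarrow> edge_arcs E \<subseteq> V \<times> V"
  using nbrs_subset nbrs_sym by (fastforce simp: edge_arcs_def)

lemma cut_size_arcs:
  assumes G: "simple_graph V E"
  shows "cut_size E S = card {(v, u) \<in> edge_arcs E. v \<in> S \<and> u \<notin> S}"
proof -
  have "bij_betw (\<lambda>(v, u). {v, u}) {(v, u) \<in> edge_arcs E. v \<in> S \<and> u \<notin> S} {e \<in> E. card (e \<inter> S) = 1}"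
    unfolding bij_betw_def
  proof
    show "inj_on (\<lambda>(v, u). {v, u}) {(v, u) \<in> edge_arcs E. v \<in> S \<and> u \<notin> S}"
      by (auto simp: inj_on_def doubleton_eq_iff)
    show "(\<lambda>(v, u). {v, u}) ` {(v, u) \<in> edge_arcs E. v \<in> S \<and> u \<notin> S} = {e \<in> E. card (e \<inter> S) = 1}"
    proof (intro equalityI subsetI)
      fix e assume "e \<in> (\<lambda>(v, u). {v, u}) ` {(v, u) \<in> edge_arcs E. v \<in> S \<and> u \<notin> S}"
      then obtain v u where "e = {v, u}" "u \<in> nbrs E v" "v \<in> S" "u \<notin> S" by (auto simp: edge_arcs_def)
      moreover from this have "e \<inter> S = {v}" by auto
      ultimately show "e \<in> {e \<in> E. card (e \<inter> S) = 1}" by (auto simp: nbrs_def)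
    next
      fix e assume e: "e \<in> {e \<in> E. card (e \<inter> S) = 1}"
      then have "card e = 2" using G by (auto simp: simple_graph_def)
      then obtain a b where ab: "e = {a, b}" "a \<noteq> b" by (auto simp: card_2_iff)
      have "e \<inter> S = (if a \<in> S then {a} else {}) \<union> (if b \<in> S then {b} else {})" using ab by auto
      then have "(a \<in> S) \<noteq> (b \<in> S)" using e ab by (auto split: if_splits)
      then consider "a \<in> S" "b \<notin> S" | "b \<in> S" "a \<notin> S" by blast
      then show "e \<in> (\<lambda>(v, u). {v, u}) ` {(v, u) \<in> edge_arcs E. v \<in> S \<and> u \<notin> S}"
      proof cases
        case 1
        then have "(a, b) \<in> {(v, u) \<in> edge_arcs E. v \<in> S \<and> u \<notin> S}"
          using e ab by (auto simp: edge_arcs_def nbrs_def)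
        then show ?thesis using ab by force
      next
        case 2
        then have "(b, a) \<in> {(v, u) \<in> edge_arcs E. v \<in> S \<and> u \<notin> S}"
          using e ab by (auto simp: edge_arcs_def nbrs_def insert_commute)
        then show ?thesis using ab by (force simp: insert_commute)
      qed
    qed
  qed
  then show ?thesis unfolding cut_size_def by (simp add: bij_betw_same_card)
qed

lemma cut_size_sum:
  assumes G: "simple_graph V E" and S: "S \<subseteq> V"
  shows "cut_size E S = (\<Sum>v\<in>S. card (nbrs E v - S))"
proof -
  have fin: "finite V" using G by (simp add: simple_graph_def)
  have "{(v, u) \<in> edge_arcs E. v \<in> S \<and> u \<notin> S} = Sigma S (\<lambda>v. nbrs E v - S)"
    by (auto simp: edge_arcs_def)
  then show ?thesis unfolding cut_size_arcs[OF G]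
    using finite_subset[OF S fin] finite_subset[OF nbrs_subset[OF G] fin] by simp
qed

lemma card_crossing_set:
  assumes G: "simple_graph V E"
  shows "card (crossing (\<lambda>v. v \<in> S) (edge_arcs E)) = 2 * cut_size E S"
proof -
  let ?A = "{(v, u) \<in> edge_arcs E. v \<in> S \<and> u \<notin> S}" and ?B = "{(v, u) \<in> edge_arcs E. u \<in> S \<and> v \<notin> S}"
  have fin: "finite (edge_arcs E)" using edge_arcs_subset[OF G] G
    by (meson finite_SigmaI finite_subset simple_graph_def)
  have "?B = prod.swap ` ?A" using nbrs_sym by (fastforce simp: edge_arcs_def image_iff)
  then have B: "card ?B = card ?A" by (simp add: card_image)
  have "crossing (\<lambda>v. v \<in> S) (edge_arcs E) = ?A \<union> ?B" by (auto simp: crossing_def)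
  moreover have "card (?A \<union> ?B) = card ?A + card ?B"
    using fin by (intro card_Un_disjoint) (auto intro: finite_subset)
  ultimately show ?thesis using B cut_size_arcs[OF G] by simp
qed

lemma cut_size_singleton:
  assumes "simple_graph V E" "v \<in> V"
  shows "cut_size E {v} = card (nbrs E v)"
  using cut_size_sum[OF assms(1), of "{v}"] assms(2) by (simp add: not_self_nbr)

text \<open>An edge between \<open>v\<close> and \<open>W\<close> is counted in both terms on the
  right but does not cross \<open>insert v W\<close>. This identity turns three cut queries into the
  number of neighbours of \<open>v\<close> in \<open>W\<close>.\<close>

lemma cut_size_insert:
  assumes G: "simple_graph V E" and W: "W \<subseteq> V" "v \<in> V" "v \<notin> W"
  shows "cut_size E (insert v W) + 2 * card (nbrs E v \<inter> W) = cut_size E {v} + cut_size E W"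
proof -
  have fin: "finite V" using G by (simp add: simple_graph_def)
  have finW: "finite W" using fin W finite_subset by auto
  have finN: "finite (nbrs E u)" for u using finite_subset[OF nbrs_subset[OF G] fin] .
  have 1: "card (nbrs E v) = card (nbrs E v - W) + card (nbrs E v \<inter> W)"
    using card_Diff_subset_Int[of "nbrs E v" W] finW card_mono[OF finN, of "nbrs E v \<inter> W" v] by simp
  have "card (nbrs E u - W) = card (nbrs E u - insert v W) + (if u \<in> nbrs E v then 1 else 0)" if "u \<in> W" for u
  proof (cases "v \<in> nbrs E u")
    case True
    then have "nbrs E u - W = insert v (nbrs E u - insert v W)" using W by auto
    moreover have "card (insert v (nbrs E u - insert v W)) = Suc (card (nbrs E u - insert v W))"
      using finN by (intro card_insert_disjoint) auto
    ultimately have "card (nbrs E u - W) = Suc (card (nbrs E u - insert v W))" by (simp only:)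
    then show ?thesis using True nbrs_sym[of u E v] by simp
  next
    case False
    then have "nbrs E u - W = nbrs E u - insert v W" by auto
    then have "card (nbrs E u - W) = card (nbrs E u - insert v W)" by (simp only:)
    then show ?thesis using False nbrs_sym[of u E v] by simp
  qed
  then have "(\<Sum>u\<in>W. card (nbrs E u - W)) = (\<Sum>u\<in>W. card (nbrs E u - insert v W)) + (\<Sum>u\<in>W. if u \<in> nbrs E v then 1 else 0)"
    by (simp add: sum.distrib)
  also have "(\<Sum>u\<in>W. if u \<in> nbrs E v then 1 else 0) = card (nbrs E v \<inter> W)"
    using finW by (simp add: sum.If_cases Int_commute)
  finally have 2: "cut_size E W = (\<Sum>u\<in>W. card (nbrs E u - insert v W)) + card (nbrs E v \<inter> W)"
    using cut_size_sum[OF G W(1)] by simp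
  have "cut_size E (insert v W) = card (nbrs E v - insert v W) + (\<Sum>u\<in>W. card (nbrs E u - insert v W))"
    using cut_size_sum[OF G, of "insert v W"] W finW by simp
  moreover have "nbrs E v - insert v W = nbrs E v - W" using not_self_nbr by fastforce
  ultimately show ?thesis using 1 2 cut_size_singleton[OF G W(2)] by simp
qed

text \<open>Moving \<open>v\<close> to the other side cannot decrease the cut. The moved set is
  nonempty and proper, for otherwise \<open>S\<close> or its complement would be \<open>{v}\<close>
  and the cut size would equal the degree of \<open>v\<close>, contradicting
  \<open>lt\<close>.\<close>

lemma crossing_nbrs_le_half:
  assumes G: "simple_graph V E" and min: "is_min_cut V E S"
    and lt: "\<And>v. v \<in> V \<Longrightarrow> cut_size E S < card (nbrs E v)" and v: "v \<in> V"
  shows "2 * card {u \<in> nbrs E v. (u \<in> S) \<noteq> (v \<in> S)} \<le> card (nbrs E v)"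
proof -
  have fin: "finite V" using G by (simp add: simple_graph_def)
  have finN: "finite (nbrs E u)" for u using finite_subset[OF nbrs_subset[OF G] fin] .
  have S: "S \<noteq> {}" "S \<subset> V" and le: "\<And>T. T \<noteq> {} \<Longrightarrow> T \<subset> V \<Longrightarrow> cut_size E S \<le> cut_size E T"
    using min by (auto simp: is_min_cut_def)
  have split: "card (nbrs E v) = card (nbrs E v \<inter> T) + card (nbrs E v - T)" for T
    using card_Int_Diff[OF finN] by simp
  show ?thesis
  proof (cases "v \<in> S")
    case True
    have "S - {v} \<noteq> {}"
    proof
      assume "S - {v} = {}"
      then have "S = {v}" using True by auto
      then show False using lt[OF v] cut_size_singleton[OF G v] by simp
    qed
    moreover have "S - {v} \<subset> V" using S(2) by auto
    ultimately have "cut_size E S \<le> cut_size E (S - {v})" by (rule le)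
    moreover have "insert v (S - {v}) = S" using True by auto
    moreover have "S - {v} \<subseteq> V" using S(2) by auto
    ultimately have "2 * card (nbrs E v \<inter> (S - {v})) \<ge> card (nbrs E v)"
      using cut_size_insert[OF G, of "S - {v}" v] v cut_size_singleton[OF G v] by simp
    moreover have "nbrs E v \<inter> (S - {v}) = nbrs E v \<inter> S" using not_self_nbr by fastforce
    moreover have "{u \<in> nbrs E v. (u \<in> S) \<noteq> (v \<in> S)} = nbrs E v - S" using True by auto
    ultimately show ?thesis using split[of S] by simp
  next
    case False
    have "insert v S \<noteq> V"
    proof
      assume eq: "insert v S = V"
      have "nbrs E v \<inter> S = nbrs E v" using nbrs_subset[OF G] not_self_nbr eq by fastforce
      moreover have "cut_size E V = 0" using cut_size_sum[OF G, of V] nbrs_subset[OF G]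
        by (simp add: Diff_eq_empty_iff[THEN iffD2])
      ultimately show False
        using cut_size_insert[OF G, of S v] False v S eq cut_size_singleton[OF G v] lt[OF v] by auto
    qed
    then have "insert v S \<subset> V" using S(2) v by auto
    then have "cut_size E S \<le> cut_size E (insert v S)" by (intro le) auto
    then have "2 * card (nbrs E v \<inter> S) \<le> card (nbrs E v)"
      using cut_size_insert[OF G, of S v] psubset_imp_subset[OF S(2)] v False
        cut_size_singleton[OF G v] by linarith
    moreover have "{u \<in> nbrs E v. (u \<in> S) \<noteq> (v \<in> S)} = nbrs E v \<inter> S" using False by auto
    ultimately show ?thesis by simp
  qed
qed

section \<open>The protocol of a single trial\<close>

definition edges_between :: "('a set \<Rightarrow> nat) \<Rightarrow> 'a \<Rightarrow> 'a set \<Rightarrow> nat" where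
  "edges_between c v W = (c {v} + c W - c (insert v W)) div 2"

definition probe :: "'a \<Rightarrow> 'a set \<Rightarrow> 'a set list" where
  "probe v W = [{v}, W, insert v W]"

lemma edges_between_cong:
  "(\<And>S. S \<in> set (probe v W) \<Longrightarrow> c S = c' S) \<Longrightarrow> edges_between c v W = edges_between c' v W"
  by (simp add: edges_between_def probe_def)

lemma edges_between_cut_size:
  assumes "simple_graph V E" "W \<subseteq> V" "v \<in> V" "v \<notin> W"
  shows "edges_between (cut_size E) v W = card (nbrs E v \<inter> W)"
proof -
  have "cut_size E {v} + cut_size E W - cut_size E (insert v W) = 2 * card (nbrs E v \<inter> W)"
    using cut_size_insert[OF assms] by linarith
  then show ?thesis by (simp add: edges_between_def)
qed

lemma agree_mono: "agree Qs t c c' \<Longrightarrow> s \<le> t \<Longrightarrow> agree Qs s c c'"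
  unfolding agree_def by (meson less_le_trans)

lemma agreeD: "agree Qs t c c' \<Longrightarrow> i < t \<Longrightarrow> S \<in> set (Qs i c) \<Longrightarrow> c S = c' S"
  by (auto simp: agree_def)

lemma card_image_coarser:
  assumes "finite V" "coarser V f g"
  shows "card (g ` V) \<le> card (f ` V)"
proof -
  have "g ` V \<subseteq> (\<lambda>y. g (inv_into V f y)) ` (f ` V)"
  proof
    fix y assume "y \<in> g ` V"
    then obtain v where v: "v \<in> V" "y = g v" by auto
    have "inv_into V f (f v) \<in> V" "f (inv_into V f (f v)) = f v"
      using v by (auto intro: inv_into_into f_inv_into_f)
    then have "g (inv_into V f (f v)) = g v" using assms(2) v unfolding coarser_def by blast
    then show "y \<in> (\<lambda>y. g (inv_into V f y)) ` (f ` V)" using v by force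
  qed
  then have "card (g ` V) \<le> card ((\<lambda>y. g (inv_into V f y)) ` (f ` V))"
    using assms by (intro card_mono) auto
  also have "\<dots> \<le> card (f ` V)" using assms by (intro card_image_le) auto
  finally show ?thesis .
qed

locale cut_setting =
  fixes V :: "'a set" and r :: nat
  assumes finV: "finite V" and r_pos: "1 \<le> r" and r_le_log: "real r \<le> log 2 (real (card V))"
begin

abbreviation n :: nat where "n \<equiv> card V"

section \<open>Parameters of the protocol\<close>

definition L :: nat where "L = nat \<lceil>log 2 (real n)\<rceil>"

text \<open>The expected number of usable centers among the neighbours of a vertex lies between
  \<open>kap\<close> and \<open>2 * kap\<close>. The factor 40 brings each tail probability at a
  single vertex below \<open>1 / (8 * n)\<close>.\<close>

definition kap :: nat where "kap = 40 * L"

definition q :: real where "q = real n powr (1 / real r)"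

text \<open>A geometric progression with ratio \<open>q\<close>, from \<open>1 / n\<close> at level
  0 to 1 at level \<open>r\<close>.\<close>

definition rate :: "nat \<Rightarrow> real" where "rate j = real n powr (real j / real r - 1)"

text \<open>The cap on the number of arcs recovered at one level. The constant exceeds twice the
  20504 of \<open>rate_bound\<close>, with room for the union bound.\<close>

definition M :: nat where "M = nat \<lceil>50000 * real L * real n * q\<rceil>"

lemma n_ge_2: "2 \<le> n"
proof -
  have 1: "1 \<le> log 2 (real n)" using r_pos r_le_log by linarith
  then have "0 < n" by (cases "n = 0") (auto simp: log_def)
  then have "2 powr 1 \<le> real n" using 1 by (simp add: le_log_iff)
  then show ?thesis by simp
qed

lemma V_nonempty: "V \<noteq> {}" using n_ge_2 by auto

lemma n_le_pow: "n \<le> 2 ^ L"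
proof -
  have "real n = 2 powr (log 2 (real n))" using n_ge_2 by simp
  also have "\<dots> \<le> 2 powr (real L)" unfolding L_def by (intro powr_mono) linarith+
  also have "\<dots> = real (2 ^ L)" by (simp add: powr_realpow)
  finally show ?thesis by (simp only: of_nat_le_iff)
qed

lemma L_pos: "1 \<le> L"
  using r_pos r_le_log unfolding L_def by linarith

section \<open>Recovering a small neighbourhood in one round\<close>

definition separators :: "nat \<Rightarrow> 'a set list" where
  "separators x = (SOME Ws. length Ws \<le> 2 * L * x + 3 \<and> set Ws \<subseteq> Pow V \<and>
    (\<forall>X Y. X \<subseteq> V \<and> Y \<subseteq> V \<and> card X \<le> x \<and> card Y \<le> x \<and> X \<noteq> Y \<longrightarrow>
       (\<exists>W\<in>set Ws. card (X \<inter> W) \<noteq> card (Y \<inter> W))))"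

lemma separators:
  "length (separators x) \<le> 2 * L * x + 3" "W \<in> set (separators x) \<Longrightarrow> W \<subseteq> V"
  "X \<subseteq> V \<Longrightarrow> Y \<subseteq> V \<Longrightarrow> card X \<le> x \<Longrightarrow> card Y \<le> x \<Longrightarrow>
   (\<And>W. W \<in> set (separators x) \<Longrightarrow> card (X \<inter> W) = card (Y \<inter> W)) \<Longrightarrow> X = Y"
  using someI_ex[OF small_set_separating_list_exists[OF finV n_le_pow, of x], folded separators_def]
  by blast+

text \<open>Any set consistent with the counts is accepted, since only queries are charged, not
  computation. If the true set has at most \<open>x\<close> elements, the separators leave no other
  choice.\<close>

definition recover :: "('a set \<Rightarrow> nat) \<Rightarrow> 'a \<Rightarrow> 'a set \<Rightarrow> nat \<Rightarrow> 'a set" where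
  "recover c v W x = (SOME Y. Y \<subseteq> W \<and> card Y \<le> x \<and>
     (\<forall>Q\<in>set (separators x). card (Y \<inter> Q) = edges_between c v (W \<inter> Q)))"

definition recover_queries :: "'a \<Rightarrow> 'a set \<Rightarrow> nat \<Rightarrow> 'a set list" where
  "recover_queries v W x = concat (map (\<lambda>Q. probe v (W \<inter> Q)) (separators x))"

lemma recover_cong:
  assumes "\<And>S. S \<in> set (recover_queries v W x) \<Longrightarrow> c S = c' S"
  shows "recover c v W x = recover c' v W x"
proof -
  have "edges_between c v (W \<inter> Q) = edges_between c' v (W \<inter> Q)" if "Q \<in> set (separators x)" for Q
    using that assms by (intro edges_between_cong) (auto simp: recover_queries_def)
  then show ?thesis by (simp add: recover_def)
qed

lemma recover_correct:
  assumes G: "simple_graph V E" and W: "W \<subseteq> V" "v \<in> V" "v \<notin> W" and x: "card (nbrs E v \<inter> W) \<le> x"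
  shows "recover (cut_size E) v W x = nbrs E v \<inter> W"
proof -
  have eb: "edges_between (cut_size E) v (W \<inter> Q) = card ((nbrs E v \<inter> W) \<inter> Q)" for Q
    using edges_between_cut_size[OF G, of "W \<inter> Q" v] W by (simp add: Int_assoc le_infI1)
  show ?thesis unfolding recover_def eb
  proof (rule some_equality)
    show "nbrs E v \<inter> W \<subseteq> W \<and> card (nbrs E v \<inter> W) \<le> x \<and>
      (\<forall>Q\<in>set (separators x). card (nbrs E v \<inter> W \<inter> Q) = card (nbrs E v \<inter> W \<inter> Q))"
      using x by simp
    fix Y assume Y: "Y \<subseteq> W \<and> card Y \<le> x \<and>
      (\<forall>Q\<in>set (separators x). card (Y \<inter> Q) = card (nbrs E v \<inter> W \<inter> Q))"
    show "Y = nbrs E v \<inter> W"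
      by (rule separators(3)[of _ _ x]) (use Y W x in auto)
  qed
qed

section \<open>Labels, samples and queries of one trial\<close>

definition vertices :: "'a list" where
  "vertices = (SOME xs. set xs = V \<and> distinct xs)"

lemma vertices: "set vertices = V" "distinct vertices" "length vertices = n"
proof -
  have "\<exists>xs. set xs = V \<and> distinct xs" using finite_distinct_list[OF finV] .
  from someI_ex[OF this, folded vertices_def]
  show "set vertices = V" "distinct vertices" by auto
  then show "length vertices = n" using distinct_card by fastforce
qed

definition min_degree :: "('a set \<Rightarrow> nat) \<Rightarrow> nat" where
  "min_degree c = Min ((\<lambda>v. c {v}) ` V)"

definition threshold :: "nat \<Rightarrow> nat" where
  "threshold d = nat \<lceil>real n * real kap / real d\<rceil>"

text \<open>One hash value per vertex is compared with all thresholds, so vertices of larger degree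
  see a subset of the same centers, about \<open>kap\<close> of them among their neighbours.\<close>

definition centers :: "('a \<Rightarrow> nat) \<Rightarrow> ('a set \<Rightarrow> nat) \<Rightarrow> 'a \<Rightarrow> 'a set" where
  "centers h c v = {u \<in> V. u \<noteq> v \<and> h u < threshold (c {v})}"

text \<open>\<open>g\<close> is indexed by the recovered set because the pick is drawn before that
  set is known. For minimum degree below \<open>kap\<close> the identity already has a small product
  of class count and minimum degree.\<close>

definition star :: "('a \<Rightarrow> nat) \<Rightarrow> ('a \<times> 'a set \<Rightarrow> 'a) \<Rightarrow> ('a set \<Rightarrow> nat) \<Rightarrow> 'a \<Rightarrow> 'a" where
  "star h g c v = (if v \<in> V \<and> kap \<le> min_degree c
     then g (v, recover c v (centers h c v) (8 * kap)) else v)"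

text \<open>From level \<open>r\<close> on the mask \<open>F\<close> is ignored, as the sampling rate reaches 1 there.\<close>

definition allowed :: "(nat \<times> 'a \<times> 'a \<Rightarrow> bool) \<Rightarrow> ('a \<Rightarrow> 'a) \<Rightarrow> nat \<Rightarrow> 'a \<Rightarrow> 'a set" where
  "allowed F f j v = {u \<in> V. (r \<le> j \<or> F (j, v, u)) \<and> f u \<noteq> f v}"

definition total :: "(nat \<times> 'a \<times> 'a \<Rightarrow> bool) \<Rightarrow> ('a \<Rightarrow> 'a) \<Rightarrow> nat \<Rightarrow> ('a set \<Rightarrow> nat) \<Rightarrow> nat" where
  "total F f j c = (\<Sum>v\<in>V. edges_between c v (allowed F f j v))"

text \<open>The empty default beyond \<open>M\<close> makes the query bound hold for every outcome
  of the coins, not just for the good ones.\<close>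

definition sampled ::
  "(nat \<times> 'a \<times> 'a \<Rightarrow> bool) \<Rightarrow> ('a \<Rightarrow> 'a) \<Rightarrow> nat \<Rightarrow> ('a set \<Rightarrow> nat) \<Rightarrow> ('a \<times> 'a) set" where
  "sampled F f j c = (if total F f j c \<le> M
     then {(v, u). v \<in> V \<and> u \<in> recover c v (allowed F f j v) (edges_between c v (allowed F f j v))}
     else {})"

text \<open>At most \<open>2 * min_degree c * rate j\<close> sampled arcs are expected across a cut
  smaller than the minimum degree; the second summand is four times that. The summand
  \<open>2 * L + 3\<close> pays for the union bounds over coarsenings and levels.\<close>

definition strength :: "('a set \<Rightarrow> nat) \<Rightarrow> nat \<Rightarrow> nat" where
  "strength c j = 2 * L + 3 + nat \<lceil>8 * real (min_degree c) * rate j\<rceil>"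

definition coarsen :: "('a \<Rightarrow> 'a) \<Rightarrow> ('a \<times> 'a) set \<Rightarrow> nat \<Rightarrow> ('a \<Rightarrow> 'a)" where
  "coarsen f0 A k = (SOME f. f ` V \<subseteq> V \<and> coarser V f0 f \<and> card (crossing f A) + k \<le> k * card (f ` V) \<and>
    (\<forall>S. coarser V f0 (\<lambda>v. v \<in> S) \<and> card (crossing (\<lambda>v. v \<in> S) A) < k \<longrightarrow> coarser V f (\<lambda>v. v \<in> S)))"

lemma coarsen:
  assumes "A \<subseteq> V \<times> V"
  shows "coarser V f0 (coarsen f0 A k)"
    "card (crossing (coarsen f0 A k) A) \<le> k * card (coarsen f0 A k ` V)"
    "coarser V f0 (\<lambda>v. v \<in> S) \<Longrightarrow> card (crossing (\<lambda>v. v \<in> S) A) < k \<Longrightarrow>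
      coarser V (coarsen f0 A k) (\<lambda>v. v \<in> S)"
  using someI_ex[OF coarsening_exists[OF finV V_nonempty assms, of f0 k], folded coarsen_def]
  by auto

primrec label ::
  "('a \<Rightarrow> nat) \<Rightarrow> ('a \<times> 'a set \<Rightarrow> 'a) \<Rightarrow> (nat \<times> 'a \<times> 'a \<Rightarrow> bool) \<Rightarrow> ('a set \<Rightarrow> nat) \<Rightarrow> nat \<Rightarrow> 'a \<Rightarrow> 'a"
  where
  "label h g F c 0 = star h g c"
| "label h g F c (Suc j) =
     coarsen (label h g F c j) (sampled F (label h g F c j) (Suc j) c) (strength c (Suc j))"

definition unions :: "('a \<Rightarrow> 'a) \<Rightarrow> 'a set set" where
  "unions f = {S. S \<noteq> {} \<and> S \<subset> V \<and> coarser V f (\<lambda>v. v \<in> S)}"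

text \<open>The labels after level \<open>r - 1\<close> are used with the sample of level
  \<open>r\<close>, which is complete, so the minimized weight is twice the cut size.\<close>

definition candidate ::
  "('a \<Rightarrow> nat) \<Rightarrow> ('a \<times> 'a set \<Rightarrow> 'a) \<Rightarrow> (nat \<times> 'a \<times> 'a \<Rightarrow> bool) \<Rightarrow> ('a set \<Rightarrow> nat) \<Rightarrow> 'a set" where
  "candidate h g F c =
    (let f = label h g F c (r - 1) in
     if unions f = {} then {}
     else arg_min_on (\<lambda>S. card (crossing (\<lambda>v. v \<in> S) (sampled F f r c))) (unions f))"

text \<open>A level needs two rounds since the exact counts of the first determine how many
  separators the second uses. The final query, in round \<open>2 * r + 2\<close>, obtains the value
  of the candidate so that trials can be compared.\<close>

definition trial_queries ::
  "('a \<Rightarrow> nat) \<Rightarrow> ('a \<times> 'a set \<Rightarrow> 'a) \<Rightarrow> (nat \<times> 'a \<times> 'a \<Rightarrow> bool) \<Rightarrow> nat \<Rightarrow> ('a set \<Rightarrow> nat) \<Rightarrow> 'a set list"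
  where
  "trial_queries h g F t c =
    (if t = 0 then map (\<lambda>v. {v}) vertices
     else if t = 1 then concat (map (\<lambda>v. recover_queries v (centers h c v) (8 * kap)) vertices)
     else if t = 2 * r + 2 then [candidate h g F c]
     else let j = t div 2; f = label h g F c (j - 1) in
       if even t then concat (map (\<lambda>v. probe v (allowed F f j v)) vertices)
       else if total F f j c \<le> M
       then concat (map (\<lambda>v. recover_queries v (allowed F f j v) (edges_between c v (allowed F f j v))) vertices)
       else [])"

lemma trial_queries_even:
  assumes "1 \<le> j" "j \<le> r" "f = label h g F c (j - 1)"
  shows "trial_queries h g F (2 * j) c = concat (map (\<lambda>v. probe v (allowed F f j v)) vertices)"
  using assms by (simp add: trial_queries_def Let_def)

lemma trial_queries_odd:
  assumes "1 \<le> j" "j \<le> r" "f = label h g F c (j - 1)"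
  shows "trial_queries h g F (Suc (2 * j)) c = (if total F f j c \<le> M
     then concat (map (\<lambda>v. recover_queries v (allowed F f j v) (edges_between c v (allowed F f j v))) vertices)
     else [])"
proof -
  have "Suc (2 * j) div 2 = j" by simp
  then show ?thesis using assms unfolding trial_queries_def Let_def by auto
qed

subsection \<open>Causality\<close>

lemma agree_singleton:
  "agree (trial_queries h g F) t c c' \<Longrightarrow> 1 \<le> t \<Longrightarrow> v \<in> V \<Longrightarrow> c {v} = c' {v}"
  by (rule agreeD[of _ t _ _ 0]) (auto simp: trial_queries_def vertices)

lemma agree_min_degree:
  assumes "agree (trial_queries h g F) t c c'" "1 \<le> t"
  shows "min_degree c = min_degree c'"
proof -
  have "(\<lambda>v. c {v}) ` V = (\<lambda>v. c' {v}) ` V"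
    using agree_singleton[OF assms] by (intro image_cong) auto
  then show ?thesis by (simp add: min_degree_def)
qed

lemma agree_centers:
  "agree (trial_queries h g F) t c c' \<Longrightarrow> 1 \<le> t \<Longrightarrow> v \<in> V \<Longrightarrow> centers h c v = centers h c' v"
  using agree_singleton[of h g F t c c' v] by (simp add: centers_def)

lemma agree_star:
  assumes "agree (trial_queries h g F) t c c'" "2 \<le> t"
  shows "star h g c = star h g c'"
proof
  fix v
  show "star h g c v = star h g c' v"
  proof (cases "v \<in> V")
    case True
    have "recover c v (centers h c v) (8 * kap) = recover c' v (centers h c v) (8 * kap)"
      using True assms(2)
      by (intro recover_cong agreeD[OF assms(1), of 1]) (auto simp: trial_queries_def vertices)
    then show ?thesis using agree_min_degree[OF assms(1)] agree_centers[OF assms(1)] assms(2) True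
      by (simp add: star_def)
  qed (simp add: star_def)
qed

lemma agree_edges_between:
  assumes "agree (trial_queries h g F) t c c'" "1 \<le> j" "j \<le> r" "2 * j + 1 \<le> t" "v \<in> V"
    and f: "f = label h g F c (j - 1)"
  shows "edges_between c v (allowed F f j v) = edges_between c' v (allowed F f j v)"
proof (rule edges_between_cong)
  fix S assume "S \<in> set (probe v (allowed F f j v))"
  then have "S \<in> set (trial_queries h g F (2 * j) c)"
    using assms(5) by (auto simp: trial_queries_even[OF assms(2,3) f] vertices)
  with assms(4) show "c S = c' S" by (intro agreeD[OF assms(1), of "2 * j"]) auto
qed

lemma agree_sampled:
  assumes ag: "agree (trial_queries h g F) t c c'" and j: "1 \<le> j" "j \<le> r" "2 * j + 2 \<le> t"
    and f: "f = label h g F c (j - 1)"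
  shows "sampled F f j c = sampled F f j c'"
proof -
  have eb: "edges_between c v (allowed F f j v) = edges_between c' v (allowed F f j v)" if "v \<in> V" for v
    using agree_edges_between[OF ag j(1,2) _ that f] j(3) by simp
  then have tot: "total F f j c = total F f j c'" by (simp add: total_def)
  show ?thesis
  proof (cases "total F f j c \<le> M")
    case True
    have "recover c v (allowed F f j v) (edges_between c v (allowed F f j v)) =
        recover c' v (allowed F f j v) (edges_between c v (allowed F f j v))" if v: "v \<in> V" for v
    proof (rule recover_cong)
      fix S assume "S \<in> set (recover_queries v (allowed F f j v) (edges_between c v (allowed F f j v)))"
      then have "S \<in> set (trial_queries h g F (Suc (2 * j)) c)"
        using True v by (auto simp: trial_queries_odd[OF j(1,2) f] vertices)
      with j(3) show "c S = c' S" by (intro agreeD[OF ag, of "Suc (2 * j)"]) auto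
    qed
    then show ?thesis using True tot eb by (auto simp: sampled_def)
  next
    case False
    then show ?thesis using tot by (simp add: sampled_def)
  qed
qed

text \<open>The samples up to level \<open>j\<close> are complete after round
  \<open>2 * j + 1\<close>; for level 0 these are the rounds for degrees and centers.\<close>

lemma agree_label:
  assumes "agree (trial_queries h g F) t c c'"
  shows "j < r \<Longrightarrow> 2 * j + 2 \<le> t \<Longrightarrow> label h g F c j = label h g F c' j"
proof (induction j)
  case 0
  then show ?case using agree_star[OF assms] by simp
next
  case (Suc j)
  then have IH: "label h g F c j = label h g F c' j" by simp
  have "sampled F (label h g F c j) (Suc j) c = sampled F (label h g F c j) (Suc j) c'"
    by (rule agree_sampled[OF assms]) (use Suc.prems in auto)
  moreover have "min_degree c = min_degree c'" using agree_min_degree[OF assms] Suc.prems by simp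
  ultimately show ?case by (simp add: IH strength_def)
qed

lemma agree_candidate:
  assumes "agree (trial_queries h g F) (2 * r + 2) c c'"
  shows "candidate h g F c = candidate h g F c'"
proof -
  have 1: "label h g F c (r - 1) = label h g F c' (r - 1)"
    using agree_label[OF assms] r_pos by simp
  have "sampled F (label h g F c (r - 1)) r c = sampled F (label h g F c (r - 1)) r c'"
    by (rule agree_sampled[OF assms]) (use r_pos in auto)
  with 1 show ?thesis by (simp add: candidate_def Let_def)
qed

lemma causal_trial_queries:
  assumes t: "t \<le> 2 * r + 2"
  shows "causal (trial_queries h g F) t (trial_queries h g F t)"
  unfolding causal_def
proof (intro allI impI)
  fix c c' assume ag: "agree (trial_queries h g F) t c c'"
  consider "t = 0" | "t = 1" | "t = 2 * r + 2" | j where "t = 2 * j" "1 \<le> j" "j \<le> r"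
    | j where "t = Suc (2 * j)" "1 \<le> j" "j \<le> r"
  proof -
    have "t = 0 \<or> t = 1 \<or> t = 2 * r + 2 \<or> (\<exists>j. (t = 2 * j \<or> t = Suc (2 * j)) \<and> 1 \<le> j \<and> j \<le> r)"
      using t by presburger
    then show ?thesis using that by blast
  qed
  then show "trial_queries h g F t c = trial_queries h g F t c'"
  proof cases
    case 1
    then show ?thesis by (simp add: trial_queries_def)
  next
    case 2
    have "map (\<lambda>v. recover_queries v (centers h c v) (8 * kap)) vertices =
        map (\<lambda>v. recover_queries v (centers h c' v) (8 * kap)) vertices"
      using agree_centers[OF ag] 2 by (intro map_cong) (auto simp: vertices)
    with 2 show ?thesis unfolding trial_queries_def by (simp del: map_eq_conv)
  next
    case 3
    then show ?thesis using agree_candidate ag by (simp add: trial_queries_def)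
  next
    case (4 j)
    have "label h g F c (j - 1) = label h g F c' (j - 1)" using agree_label[OF ag] 4 by simp
    with 4 show ?thesis by (simp only: trial_queries_even)
  next
    case (5 j)
    define f where "f = label h g F c (j - 1)"
    have lab: "label h g F c' (j - 1) = f" unfolding f_def using agree_label[OF ag] 5 by simp
    have eb: "edges_between c v (allowed F f j v) = edges_between c' v (allowed F f j v)" if "v \<in> V" for v
      using agree_edges_between[OF ag _ _ _ that f_def] 5 by simp
    have tot: "total F f j c = total F f j c'" using eb by (simp add: total_def)
    have "map (\<lambda>v. recover_queries v (allowed F f j v) (edges_between c v (allowed F f j v))) vertices =
        map (\<lambda>v. recover_queries v (allowed F f j v) (edges_between c' v (allowed F f j v))) vertices"
      using eb by (intro map_cong) (auto simp: vertices)
    then show ?thesis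
      unfolding 5(1) trial_queries_odd[OF 5(2,3) f_def] trial_queries_odd[OF 5(2,3) lab[symmetric]] tot
      by (simp only:)
  qed
qed

end

context cut_setting
begin

subsection \<open>Legality and number of queries\<close>

lemma finite_unions: "finite (unions f)"
  by (rule finite_subset[of _ "Pow V"]) (auto simp: unions_def finV)

lemma candidate_in_unions:
  assumes "unions (label h g F c (r - 1)) \<noteq> {}"
  shows "candidate h g F c \<in> unions (label h g F c (r - 1))"
    "T \<in> unions (label h g F c (r - 1)) \<Longrightarrow>
      card (crossing (\<lambda>v. v \<in> candidate h g F c) (sampled F (label h g F c (r - 1)) r c))
        \<le> card (crossing (\<lambda>v. v \<in> T) (sampled F (label h g F c (r - 1)) r c))"
proof -
  let ?w = "\<lambda>S. card (crossing (\<lambda>v. v \<in> S) (sampled F (label h g F c (r - 1)) r c))"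
  have eq: "candidate h g F c = arg_min_on ?w (unions (label h g F c (r - 1)))"
    using assms by (simp add: candidate_def Let_def)
  show "candidate h g F c \<in> unions (label h g F c (r - 1))"
    unfolding eq by (rule arg_min_if_finite(1)[OF finite_unions assms])
  assume "T \<in> unions (label h g F c (r - 1))"
  then show "?w (candidate h g F c) \<le> ?w T"
    unfolding eq using arg_min_if_finite(2)[OF finite_unions assms, of ?w] by (meson not_less)
qed

lemma candidate_subset: "candidate h g F c \<subseteq> V"
proof (cases "unions (label h g F c (r - 1)) = {}")
  case True
  then show ?thesis by (simp add: candidate_def)
next
  case False
  then show ?thesis using candidate_in_unions(1)[OF False] by (auto simp: unions_def)
qed

lemma recover_queries_subset:
  "S \<in> set (recover_queries v W x) \<Longrightarrow> v \<in> V \<Longrightarrow> W \<subseteq> V \<Longrightarrow> S \<subseteq> V"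
  by (auto simp: recover_queries_def probe_def split: if_splits)

lemma centers_subset: "centers h c v \<subseteq> V"
  by (auto simp: centers_def)

lemma allowed_subset: "allowed F f j v \<subseteq> V"
  by (auto simp: allowed_def)

lemma trial_queries_subset:
  assumes "S \<in> set (trial_queries h g F t c)"
  shows "S \<subseteq> V"
proof -
  have 1: "S \<subseteq> V" if "S \<in> set (recover_queries v W x)" "v \<in> V" "W \<subseteq> V" for v W x
    using that recover_queries_subset by blast
  have 2: "S \<subseteq> V" if "S \<in> set (probe v W)" "v \<in> V" "W \<subseteq> V" for v W
    using that by (auto simp: probe_def)
  show ?thesis
    using assms 1[OF _ _ centers_subset] 1[OF _ _ allowed_subset] 2[OF _ _ allowed_subset] candidate_subset
    unfolding trial_queries_def Let_def by (fastforce simp: vertices split: if_splits)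
qed

lemma length_recover_queries: "length (recover_queries v W x) \<le> 6 * L * x + 9"
proof -
  have "length (recover_queries v W x) = 3 * length (separators x)"
    by (simp add: recover_queries_def probe_def length_concat o_def sum_list_triv)
  then show ?thesis using separators(1)[of x] by simp
qed

lemma length_concat_vertices: "length (concat (map f vertices)) = (\<Sum>v\<in>V. length (f v))"
  using sum_list_distinct_conv_sum_set[OF vertices(2), of "\<lambda>v. length (f v)"]
  by (simp add: length_concat o_def vertices)

text \<open>One figure for all rounds. The round for the centers costs
  \<open>6 * L * (8 * kap) + 9\<close> per vertex; in a recovery round of a level the sizes add up
  to at most \<open>M\<close>, as otherwise nothing is asked.\<close>

lemma length_trial_queries:
  "length (trial_queries h g F t c) \<le> 48 * L * kap * n + 12 * n + 6 * L * M"
proof -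
  have star: "(\<Sum>v\<in>V. length (recover_queries v (W v) (8 * kap))) \<le> 48 * L * kap * n + 12 * n" for W
  proof -
    have "(\<Sum>v\<in>V. length (recover_queries v (W v) (8 * kap))) \<le> (\<Sum>v\<in>V. 48 * L * kap + 12)"
      by (intro sum_mono order_trans[OF length_recover_queries]) simp
    then show ?thesis by (simp add: algebra_simps)
  qed
  have level: "(\<Sum>v\<in>V. length (recover_queries v (W v) (x v))) \<le> 12 * n + 6 * L * M"
    if "(\<Sum>v\<in>V. x v) \<le> M" for W x
  proof -
    have "(\<Sum>v\<in>V. length (recover_queries v (W v) (x v))) \<le> (\<Sum>v\<in>V. 6 * L * x v + 9)"
      by (intro sum_mono length_recover_queries)
    also have "\<dots> = 6 * L * (\<Sum>v\<in>V. x v) + 9 * n" by (simp add: sum.distrib sum_distrib_left)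
    also have "6 * L * (\<Sum>v\<in>V. x v) \<le> 6 * L * M" using that by (intro mult_left_mono) auto
    finally show ?thesis by simp
  qed
  have probes: "(\<Sum>v\<in>V. length (probe v (W v))) = 3 * n" for W by (simp add: probe_def)
  have 1: "length (concat (map (\<lambda>v. recover_queries v (centers h c v) (8 * kap)) vertices))
      \<le> 48 * L * kap * n + 12 * n + 6 * L * M"
    unfolding length_concat_vertices using star[of "centers h c"] by simp
  have 2: "length (concat (map (\<lambda>v. probe v (allowed F f j v)) vertices))
      \<le> 48 * L * kap * n + 12 * n + 6 * L * M" for f j
    unfolding length_concat_vertices probes by simp
  have 3: "length (concat (map (\<lambda>v. recover_queries v (allowed F f j v) (edges_between c v (allowed F f j v))) vertices))
      \<le> 48 * L * kap * n + 12 * n + 6 * L * M" if "total F f j c \<le> M" for f j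
    unfolding length_concat_vertices
    using level[of "\<lambda>v. edges_between c v (allowed F f j v)" "\<lambda>v. allowed F f j v"] that
    by (simp add: total_def)
  have 4: "n \<le> 48 * L * kap * n + 12 * n + 6 * L * M" "1 \<le> 48 * L * kap * n + 12 * n + 6 * L * M"
    using n_ge_2 by auto
  show ?thesis unfolding trial_queries_def Let_def using 1 2 3 4 by (auto simp: vertices)
qed

subsection \<open>Deterministic correctness of a trial\<close>

definition marked :: "'a set set \<Rightarrow> (nat \<times> 'a \<times> 'a \<Rightarrow> bool) \<Rightarrow> nat \<Rightarrow> ('a \<times> 'a) set" where
  "marked E F j = {(v, u) \<in> edge_arcs E. r \<le> j \<or> F (j, v, u)}"

lemma crossing_marked:
  assumes "simple_graph V E"
  shows "crossing f (marked E F j) = (SIGMA v:V. nbrs E v \<inter> allowed F f j v)"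
  using edge_arcs_subset[OF assms]
  by (fastforce simp: crossing_def marked_def allowed_def edge_arcs_def)

lemma finite_nbrs: "simple_graph V E \<Longrightarrow> finite (nbrs E v)"
  using finite_subset[OF nbrs_subset finV] .

lemma finite_edge_arcs: "simple_graph V E \<Longrightarrow> finite (edge_arcs E)"
  using finite_subset[OF edge_arcs_subset] finV by blast

lemma edges_between_allowed:
  assumes "simple_graph V E" "v \<in> V"
  shows "edges_between (cut_size E) v (allowed F f j v) = card (nbrs E v \<inter> allowed F f j v)"
  using assms allowed_subset by (intro edges_between_cut_size) (auto simp: allowed_def)

lemma total_correct:
  assumes G: "simple_graph V E"
  shows "total F f j (cut_size E) = card (crossing f (marked E F j))"
  unfolding total_def crossing_marked[OF G]
  using finV finite_nbrs[OF G] edges_between_allowed[OF G] by (subst card_SigmaI) auto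

lemma sampled_correct:
  assumes G: "simple_graph V E" and "card (crossing f (marked E F j)) \<le> M"
  shows "sampled F f j (cut_size E) = crossing f (marked E F j)"
proof -
  have "recover (cut_size E) v (allowed F f j v) (edges_between (cut_size E) v (allowed F f j v))
      = nbrs E v \<inter> allowed F f j v" if "v \<in> V" for v
    using that edges_between_allowed[OF G that] allowed_subset
    by (intro recover_correct[OF G]) (auto simp: allowed_def)
  then show ?thesis using assms(2) unfolding sampled_def total_correct[OF G]
    by (auto simp: crossing_marked[OF G])
qed

text \<open>Merging classes only loses crossing arcs, so knowing the sample between different labels
  of \<open>f\<close> suffices for every coarsening of \<open>f\<close>.\<close>

lemma crossing_coarser:
  assumes "coarser V f f'" "A \<subseteq> V \<times> V"
  shows "crossing f' (crossing f A) = crossing f' A"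
  using assms unfolding crossing_def coarser_def by blast

text \<open>After level \<open>j\<close>, \<open>S\<close> is still a union of classes and at most
  \<open>\<theta> j\<close> arcs cross. The hypotheses range over all coarsenings of
  \<open>s\<close> because the labels actually reached depend on the samples.\<close>

lemma trial_success:
  assumes G: "simple_graph V E" and S: "is_min_cut V E S"
    and s: "s = star h g (cut_size E)" and sS: "coarser V s (\<lambda>v. v \<in> S)"
    and sparse: "\<And>j f :: 'a \<Rightarrow> 'a. 1 \<le> j \<Longrightarrow> j < r \<Longrightarrow> coarser V s f \<Longrightarrow>
       \<theta> j < real (card (crossing f (edge_arcs E))) \<Longrightarrow>
       strength (cut_size E) j * card (s ` V) < card (crossing f (marked E F j))"
    and small: "\<And>j f :: 'a \<Rightarrow> 'a. 1 \<le> j \<Longrightarrow> j < r \<Longrightarrow> coarser V s f \<Longrightarrow>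
       real (card (crossing f (edge_arcs E))) \<le> \<theta> (j - 1) \<Longrightarrow> card (crossing f (marked E F j)) \<le> M"
    and cut: "\<And>j. 1 \<le> j \<Longrightarrow> j < r \<Longrightarrow>
       card (crossing (\<lambda>v. v \<in> S) (marked E F j)) < strength (cut_size E) j"
    and start: "real (card (crossing s (edge_arcs E))) \<le> \<theta> 0" and final: "\<theta> (r - 1) \<le> real M"
  shows "is_min_cut V E (candidate h g F (cut_size E))"
proof -
  define lab where "lab = label h g F (cut_size E)"
  have arcs: "edge_arcs E \<subseteq> V \<times> V" using edge_arcs_subset[OF G] .
  have markV: "marked E F j \<subseteq> V \<times> V" for j using arcs by (auto simp: marked_def)
  have finm: "finite (marked E F j)" for j
    using finite_edge_arcs[OF G] by (rule finite_subset[rotated]) (auto simp: marked_def)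
  have inv: "coarser V s (lab j) \<and> coarser V (lab j) (\<lambda>v. v \<in> S) \<and>
      real (card (crossing (lab j) (edge_arcs E))) \<le> \<theta> j" if "j < r" for j
    using that
  proof (induction j)
    case 0
    then show ?case using sS start coarser_refl by (simp add: lab_def s)
  next
    case (Suc j)
    define f where "f = lab j"
    define k where "k = strength (cut_size E) (Suc j)"
    define A where "A = sampled F f (Suc j) (cut_size E)"
    define f' where "f' = coarsen f A k"
    have f': "lab (Suc j) = f'" by (simp add: lab_def f'_def f_def A_def k_def)
    have IH: "coarser V s f" "coarser V f (\<lambda>v. v \<in> S)" "real (card (crossing f (edge_arcs E))) \<le> \<theta> j"
      using Suc by (simp_all add: f_def)
    have A: "A = crossing f (marked E F (Suc j))" unfolding A_def
      using small[of "Suc j" f] IH Suc.prems by (intro sampled_correct[OF G]) simp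
    have AV: "A \<subseteq> V \<times> V" unfolding A using markV by (auto simp: crossing_def)
    have ff': "coarser V f f'" unfolding f'_def by (rule coarsen(1)[OF AV])
    have sf': "coarser V s f'" using coarser_trans[OF IH(1) ff'] .
    have "card (crossing (\<lambda>v. v \<in> S) A) \<le> card (crossing (\<lambda>v. v \<in> S) (marked E F (Suc j)))"
      unfolding A using finm by (intro card_mono) (auto simp: crossing_def intro: finite_subset)
    also have "\<dots> < k" unfolding k_def using cut[of "Suc j"] Suc.prems by simp
    finally have "coarser V f' (\<lambda>v. v \<in> S)" unfolding f'_def by (rule coarsen(3)[OF AV IH(2)])
    moreover have "real (card (crossing f' (edge_arcs E))) \<le> \<theta> (Suc j)"
    proof (rule ccontr)
      assume "\<not> ?thesis"
      \<comment> \<open>With too many crossing arcs, \<open>sparse\<close> would force more sampled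
        ones than \<open>coarsen\<close> permits. Classes are only merged, so the class count of
        \<open>s\<close> bounds that of \<open>f'\<close>.\<close>
      then have "k * card (s ` V) < card (crossing f' (marked E F (Suc j)))"
        unfolding k_def using sparse[of "Suc j" f'] Suc.prems sf' by simp
      also have "crossing f' (marked E F (Suc j)) = crossing f' A"
        unfolding A using crossing_coarser[OF ff' markV] by simp
      also have "card (crossing f' A) \<le> k * card (f' ` V)" unfolding f'_def by (rule coarsen(2)[OF AV])
      also have "\<dots> \<le> k * card (s ` V)" using card_image_coarser[OF finV sf'] by simp
      finally show False by simp
    qed
    ultimately show ?case using sf' f' by simp
  qed
  define f where "f = lab (r - 1)"
  have f: "coarser V f (\<lambda>v. v \<in> S)" "real (card (crossing f (edge_arcs E))) \<le> \<theta> (r - 1)"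
    using inv[of "r - 1"] r_pos by (simp_all add: f_def)
  have mr: "marked E F r = edge_arcs E" by (simp add: marked_def)
  \<comment> \<open>Level \<open>r\<close> involves no sampling: all arcs between different labels
    fit under the cap and are recovered.\<close>
  have A: "sampled F f r (cut_size E) = crossing f (edge_arcs E)"
    using sampled_correct[OF G, of f F r] f(2) final unfolding mr by simp
  have uS: "S \<in> unions f" using S f(1) by (simp add: unions_def is_min_cut_def)
  have val: "card (crossing (\<lambda>v. v \<in> T) (sampled F f r (cut_size E))) = 2 * cut_size E T"
    if "T \<in> unions f" for T
    using that crossing_coarser[OF _ arcs, of f "\<lambda>v. v \<in> T"] card_crossing_set[OF G]
    by (simp add: A unions_def)
  define T where "T = candidate h g F (cut_size E)"
  have ne: "unions (label h g F (cut_size E) (r - 1)) \<noteq> {}" using uS by (auto simp: f_def lab_def)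
  have T: "T \<in> unions f" using candidate_in_unions(1)[OF ne] by (simp add: T_def f_def lab_def)
  have "cut_size E T \<le> cut_size E S"
    using candidate_in_unions(2)[OF ne, of S] uS val[OF uS] val[OF T] by (simp add: T_def f_def lab_def)
  from order_trans[OF this] have "is_min_cut V E T"
    using T S by (simp add: is_min_cut_def unions_def)
  then show ?thesis by (simp add: T_def)
qed

end

section \<open>Probability estimates\<close>

text \<open>Fubini for an event in the second coordinate that depends on the first, given a lower
  bound uniform over \<open>X\<close>.\<close>

lemma prob_pair_pmf_ge:
  assumes X: "a \<le> measure_pmf.prob A X" and Y: "\<And>x. x \<in> X \<Longrightarrow> b \<le> measure_pmf.prob B (Y x)"
    and b: "0 \<le> b"
  shows "a * b \<le> measure_pmf.prob (pair_pmf A B) {(x, y). x \<in> X \<and> y \<in> Y x}"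
proof -
  let ?S = "{(x, y). x \<in> X \<and> y \<in> Y x}"
  have "ennreal (a * b) \<le> ennreal (measure_pmf.prob A X * b)"
    using X b by (intro ennreal_leI mult_right_mono) auto
  also have "\<dots> = emeasure A X * ennreal b"
    by (simp add: measure_pmf.emeasure_eq_measure ennreal_mult b)
  also have "\<dots> = (\<integral>\<^sup>+x. indicator X x * ennreal b \<partial>measure_pmf A)"
    by (subst nn_integral_multc) auto
  also have "\<dots> \<le> (\<integral>\<^sup>+x. \<integral>\<^sup>+y. indicator ?S (x, y) \<partial>measure_pmf B \<partial>measure_pmf A)"
  proof (rule nn_integral_mono)
    fix x
    show "indicator X x * ennreal b \<le> (\<integral>\<^sup>+y. indicator ?S (x, y) \<partial>measure_pmf B)"
    proof (cases "x \<in> X")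
      case True
      have "ennreal b \<le> emeasure B (Y x)"
        using Y[OF True] by (simp add: measure_pmf.emeasure_eq_measure ennreal_leI)
      also have "\<dots> = (\<integral>\<^sup>+y. indicator (Y x) y \<partial>measure_pmf B)" by simp
      also have "\<dots> = (\<integral>\<^sup>+y. indicator ?S (x, y) \<partial>measure_pmf B)"
        using True by (intro nn_integral_cong) (auto simp: indicator_def)
      finally show ?thesis using True by simp
    qed simp
  qed
  also have "\<dots> = (\<integral>\<^sup>+z. indicator ?S z \<partial>measure_pmf (pair_pmf A B))"
    by (rule nn_integral_pair_pmf'[symmetric])
  also have "\<dots> = ennreal (measure_pmf.prob (pair_pmf A B) ?S)"
    by (simp add: measure_pmf.emeasure_eq_measure)
  finally show ?thesis by (simp add: ennreal_le_iff)
qed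

text \<open>The generating function of a binomial count; the tail bounds evaluate it at 2 and at
  1/2.\<close>

lemma expectation_power_count:
  fixes z :: real
  assumes I: "finite I" "A \<subseteq> I" and z: "0 \<le> z" and p: "\<And>i. i \<in> A \<Longrightarrow> measure_pmf.prob (p i) (B i) = \<rho>"
  shows "measure_pmf.expectation (Pi_pmf I d p) (\<lambda>\<omega>. z ^ card {i \<in> A. \<omega> i \<in> B i}) = (1 + (z - 1) * \<rho>) ^ card A"
proof -
  define f where "f = (\<lambda>i y. if i \<in> A \<and> y \<in> B i then z else 1)"
  have finA: "finite A" using I finite_subset by blast
  have eq: "z ^ card {i \<in> A. \<omega> i \<in> B i} = (\<Prod>i\<in>I. f i (\<omega> i))" for \<omega>
  proof -
    have "(\<Prod>i\<in>I. f i (\<omega> i)) = (\<Prod>i\<in>{i \<in> A. \<omega> i \<in> B i}. z)"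
      unfolding f_def by (rule prod.mono_neutral_cong_right) (use I in auto)
    then show ?thesis by simp
  qed
  have int: "integrable (measure_pmf (p i)) (f i)" for i
    by (rule measure_pmf.integrable_const_bound[where B = "max z 1"]) (use z in \<open>auto simp: f_def\<close>)
  have val: "measure_pmf.expectation (p i) (f i) = (if i \<in> A then 1 + (z - 1) * \<rho> else 1)" for i
  proof (cases "i \<in> A")
    case True
    then have fi: "f i = (\<lambda>y. 1 + (z - 1) * indicator (B i) y)" by (auto simp: f_def)
    have "measure_pmf.expectation (p i) (\<lambda>y. 1 + (z - 1) * indicator (B i) y) =
        measure_pmf.expectation (p i) (\<lambda>y. 1) + measure_pmf.expectation (p i) (\<lambda>y. (z - 1) * indicator (B i) y)"
      by (intro Bochner_Integration.integral_add)
        (auto intro!: integrable_mult_right measure_pmf.integrable_const_bound[where B = 1])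
    then have "measure_pmf.expectation (p i) (f i) = 1 + (z - 1) * measure_pmf.prob (p i) (B i)"
      unfolding fi by (simp add: measure_pmf.prob_space)
    then show ?thesis using True p by simp
  next
    case False
    then have "f i = (\<lambda>y. 1)" by (auto simp: f_def)
    then show ?thesis using False by simp
  qed
  have "measure_pmf.expectation (Pi_pmf I d p) (\<lambda>\<omega>. z ^ card {i \<in> A. \<omega> i \<in> B i})
      = (\<Prod>i\<in>I. measure_pmf.expectation (p i) (f i))"
    unfolding eq by (rule expectation_prod_Pi_pmf[OF I(1) int]) (use z in \<open>auto simp: f_def\<close>)
  also have "\<dots> = (\<Prod>i\<in>I. if i \<in> A then 1 + (z - 1) * \<rho> else 1)" by (simp only: val)
  also have "\<dots> = (\<Prod>i\<in>A. 1 + (z - 1) * \<rho>)"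
    by (rule prod.mono_neutral_cong_right) (use I in auto)
  finally show ?thesis by simp
qed

lemma integrable_power_count:
  fixes z :: real
  assumes "finite A" "0 \<le> z"
  shows "integrable (measure_pmf P) (\<lambda>\<omega>. z ^ card {i \<in> A. \<omega> i \<in> B i})"
proof (rule measure_pmf.integrable_const_bound[where B = "max z 1 ^ card A"])
  have "z ^ card {i \<in> A. \<omega> i \<in> B i} \<le> max z 1 ^ card A" for \<omega>
  proof -
    have "z ^ card {i \<in> A. \<omega> i \<in> B i} \<le> max z 1 ^ card {i \<in> A. \<omega> i \<in> B i}"
      using assms by (intro power_mono) auto
    also have "\<dots> \<le> max z 1 ^ card A" using assms by (intro power_increasing card_mono) auto
    finally show ?thesis .
  qed
  then show "AE \<omega> in measure_pmf P. norm (z ^ card {i \<in> A. \<omega> i \<in> B i}) \<le> max z 1 ^ card A"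
    using assms by (intro AE_I2) simp
qed simp

text \<open>Markov's inequality for 2 to the power of the count. Base 2 keeps the result comparable
  with the power of two that bounds the number of coarsenings.\<close>

lemma prob_count_ge:
  assumes I: "finite I" "A \<subseteq> I" and p: "\<And>i. i \<in> A \<Longrightarrow> measure_pmf.prob (p i) (B i) = \<rho>"
    and \<rho>: "0 \<le> \<rho>"
  shows "measure_pmf.prob (Pi_pmf I d p) {\<omega>. k \<le> card {i \<in> A. \<omega> i \<in> B i}} \<le> exp (\<rho> * card A) / 2 ^ k"
proof -
  let ?u = "\<lambda>\<omega>. (2::real) ^ card {i \<in> A. \<omega> i \<in> B i}"
  have finA: "finite A" using I finite_subset by blast
  have "measure_pmf.prob (Pi_pmf I d p) {\<omega>. k \<le> card {i \<in> A. \<omega> i \<in> B i}}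
      = measure_pmf.prob (Pi_pmf I d p) {\<omega> \<in> space (measure_pmf (Pi_pmf I d p)). 2 ^ k \<le> ?u \<omega>}"
    by (intro arg_cong[where f = "measure_pmf.prob _"]) auto
  also have "\<dots> \<le> measure_pmf.expectation (Pi_pmf I d p) ?u / 2 ^ k"
    using integrable_power_count[OF finA, of 2]
    by (intro integral_Markov_inequality_measure[where A = UNIV]) auto
  also have "measure_pmf.expectation (Pi_pmf I d p) ?u = (1 + \<rho>) ^ card A"
    using expectation_power_count[OF I _ p, of 2] by simp
  also have "(1 + \<rho>) ^ card A \<le> exp \<rho> ^ card A" using \<rho> by (intro power_mono) auto
  also have "exp \<rho> ^ card A = exp (\<rho> * card A)" by (simp add: exp_of_nat_mult[symmetric] mult.commute)
  finally show ?thesis by (simp add: divide_right_mono)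
qed

lemma prob_count_le:
  assumes I: "finite I" "A \<subseteq> I" and p: "\<And>i. i \<in> A \<Longrightarrow> measure_pmf.prob (p i) (B i) = \<rho>"
    and \<rho>: "0 \<le> \<rho>" "\<rho> \<le> 1"
  shows "measure_pmf.prob (Pi_pmf I d p) {\<omega>. card {i \<in> A. \<omega> i \<in> B i} \<le> k} \<le> 2 ^ k * exp (- (\<rho> * card A / 2))"
proof -
  let ?u = "\<lambda>\<omega>. (1 / 2 :: real) ^ card {i \<in> A. \<omega> i \<in> B i}"
  have finA: "finite A" using I finite_subset by blast
  have "measure_pmf.prob (Pi_pmf I d p) {\<omega>. card {i \<in> A. \<omega> i \<in> B i} \<le> k}
      = measure_pmf.prob (Pi_pmf I d p) {\<omega> \<in> space (measure_pmf (Pi_pmf I d p)). (1 / 2) ^ k \<le> ?u \<omega>}"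
    by (intro arg_cong[where f = "measure_pmf.prob _"]) (auto simp: power_decreasing_iff)
  also have "\<dots> \<le> measure_pmf.expectation (Pi_pmf I d p) ?u / (1 / 2) ^ k"
    using integrable_power_count[OF finA, of "1 / 2"]
    by (intro integral_Markov_inequality_measure[where A = UNIV]) auto
  also have "measure_pmf.expectation (Pi_pmf I d p) ?u = (1 - \<rho> / 2) ^ card A"
    using expectation_power_count[OF I _ p, of "1 / 2"] by simp
  also have "(1 - \<rho> / 2) ^ card A \<le> exp (- (\<rho> / 2)) ^ card A"
    using \<rho> exp_ge_add_one_self[of "- (\<rho> / 2)"] by (intro power_mono) auto
  also have "exp (- (\<rho> / 2)) ^ card A = exp (- (\<rho> * card A / 2))"
    by (simp add: exp_of_nat_mult[symmetric] mult.commute)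
  finally show ?thesis by (simp add: divide_right_mono power_divide mult.commute)
qed

text \<open>A first-moment bound, because the events may be dependent: arcs into the same vertex
  share its hash value.\<close>

lemma prob_card_ge_markov:
  assumes J: "finite J" and \<mu>: "(\<Sum>j\<in>J. measure_pmf.prob P (Ev j)) \<le> \<mu>" and a: "0 < a"
  shows "measure_pmf.prob P {\<omega>. a \<le> real (card {j \<in> J. \<omega> \<in> Ev j})} \<le> \<mu> / a"
proof -
  let ?u = "\<lambda>\<omega>. \<Sum>j\<in>J. indicator (Ev j) \<omega> :: real"
  have eq: "real (card {j \<in> J. \<omega> \<in> Ev j}) = ?u \<omega>" for \<omega>
    using J by (simp add: indicator_def sum.If_cases Int_def)
  have int: "integrable (measure_pmf P) ?u"
    by (intro Bochner_Integration.integrable_sum measure_pmf.integrable_const_bound[where B = 1]) auto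
  have "measure_pmf.prob P {\<omega>. a \<le> real (card {j \<in> J. \<omega> \<in> Ev j})}
      = measure_pmf.prob P {\<omega> \<in> space (measure_pmf P). a \<le> ?u \<omega>}"
    by (simp add: eq)
  also have "\<dots> \<le> measure_pmf.expectation P ?u / a"
    using int a by (intro integral_Markov_inequality_measure[where A = UNIV]) (auto intro!: AE_I2 sum_nonneg)
  also have "measure_pmf.expectation P ?u = (\<Sum>j\<in>J. measure_pmf.prob P (Ev j))"
    by (subst Bochner_Integration.integral_sum)
      (auto intro!: measure_pmf.integrable_const_bound[where B = 1])
  also have "\<dots> / a \<le> \<mu> / a" using \<mu> a by (simp add: divide_right_mono)
  finally show ?thesis .
qed

lemma exp_le_4_powr: "0 \<le> x \<Longrightarrow> exp x \<le> 2 powr (2 * x)" for x :: real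
proof -
  assume x: "0 \<le> x"
  have "1 \<le> 2 * ln (2::real)" using ln2_ge_two_thirds by simp
  then have "x * 1 \<le> x * (2 * ln 2)" using x by (intro mult_left_mono)
  then show ?thesis by (simp add: powr_def mult_ac)
qed

lemma exp_minus_le_2_powr: "0 \<le> x \<Longrightarrow> exp (- x) \<le> 2 powr (- x)" for x :: real
proof -
  assume x: "0 \<le> x"
  have "x * ln 2 \<le> x * (1::real)" using x ln2_le_25_over_36 by (intro mult_left_mono) auto
  then show ?thesis by (simp add: powr_def)
qed

lemma prob_ge_one_minus:
  assumes "measure_pmf.prob P (- X) \<le> \<epsilon>"
  shows "1 - \<epsilon> \<le> measure_pmf.prob P X"
  using assms measure_pmf.prob_compl[of X P] by (simp add: Compl_eq_Diff_UNIV)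

context cut_setting
begin

subsection \<open>Sampling masks\<close>

definition masks :: "(nat \<times> 'a \<times> 'a \<Rightarrow> bool) pmf" where
  "masks = Pi_pmf ({1..<r} \<times> V \<times> V) False (\<lambda>x. bernoulli_pmf (rate (fst x)))"

lemma rate_pos: "0 < rate j" using n_ge_2 by (simp add: rate_def)

lemma rate_le_1: "j \<le> r \<Longrightarrow> rate j \<le> 1"
proof -
  assume "j \<le> r"
  then have "real j / real r - 1 \<le> 0" using r_pos by simp
  then have "real n powr (real j / real r - 1) \<le> real n powr 0" using n_ge_2 by (intro powr_mono) auto
  then show ?thesis using n_ge_2 by (simp add: rate_def)
qed

lemma rate_Suc: "rate (Suc j) = q * rate j"
  by (simp add: rate_def q_def powr_add[symmetric] add_divide_distrib algebra_simps)

lemma rate_0: "rate 0 = 1 / real n"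
  using n_ge_2 by (simp add: rate_def powr_minus inverse_eq_divide)

lemma rate_r: "rate r = 1"
  using r_pos n_ge_2 by (simp add: rate_def)

lemma q_ge_1: "1 \<le> q"
  unfolding q_def using n_ge_2 by (intro ge_one_powr_ge_zero) auto

text \<open>The value of \<theta>. With this many crossing arcs the expected sample is
  \<open>4 * strength c j * m\<close>, so that a sample of at most \<open>strength c j * m\<close>
  has probability at most \<open>2 powr (- (strength c j * m))\<close>. At level 0 all pairs are
  counted.\<close>

definition bound :: "('a set \<Rightarrow> nat) \<Rightarrow> nat \<Rightarrow> nat \<Rightarrow> real" where
  "bound c m j = (if j = 0 then real n ^ 2 else 4 * real (strength c j) * real m / rate j)"

lemma strength_ge: "real (strength c j) \<ge> 2 * L + 3 + 8 * real (min_degree c) * rate j"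
  unfolding strength_def by (simp add: of_nat_nat) linarith

lemma strength_le: "real (strength c j) \<le> 2 * L + 4 + 8 * real (min_degree c) * rate j"
proof -
  have "0 \<le> 8 * real (min_degree c) * rate j" using rate_pos[of j] by simp
  then show ?thesis unfolding strength_def by simp linarith
qed

text \<open>The bound on \<open>m * min_degree c\<close> eliminates the degree:
  \<open>strength c j * m\<close> is at most \<open>(2 * L + 4) * n + 8 * 16 * kap * n\<close>,
  hence at most \<open>5126 * L * n\<close>, and the factor \<open>4 * q\<close> gives
  20504.\<close>

lemma rate_bound:
  assumes m: "m \<le> n" "m * min_degree c \<le> 16 * kap * n" and j: "j < r"
  shows "rate (Suc j) * bound c m j \<le> 20504 * (real L * real n * q)"
proof (cases "j = 0")
  case True
  have "rate (Suc j) * bound c m j = real n * q"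
    using True rate_Suc[of 0] rate_0 n_ge_2 by (simp add: bound_def power2_eq_square)
  also have "\<dots> \<le> real L * (real n * q)" using L_pos q_ge_1 mult_right_mono[of 1 "real L" "real n * q"] by simp
  also have "\<dots> \<le> 20504 * (real L * real n * q)" using q_ge_1 by simp
  finally show ?thesis .
next
  case False
  have "real (strength c j) * m \<le> (2 * L + 4 + 8 * real (min_degree c) * rate j) * m"
    using strength_le by (intro mult_right_mono) auto
  also have "\<dots> \<le> (2 * L + 4 + 8 * real (min_degree c) * 1) * m"
    using rate_le_1[of j] j by (intro mult_right_mono add_left_mono mult_left_mono) auto
  also have "\<dots> = (2 * L + 4) * real m + 8 * real (m * min_degree c)" by (simp add: algebra_simps)
  also have "\<dots> \<le> (2 * L + 4) * real n + 8 * real (16 * kap * n)"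
    using m by (intro add_mono mult_left_mono) (auto simp only: of_nat_le_iff of_nat_0_le_iff)
  also have "\<dots> = 5122 * (real L * real n) + 4 * (1 * real n)" by (simp add: kap_def algebra_simps)
  also have "\<dots> \<le> 5122 * (real L * real n) + 4 * (real L * real n)"
    using L_pos by (intro add_left_mono mult_left_mono mult_right_mono) auto
  finally have "real (strength c j) * m \<le> 5126 * (real L * real n)" by (simp add: mult.commute)
  then have "4 * q * (real (strength c j) * m) \<le> 4 * q * (5126 * (real L * real n))"
    using q_ge_1 by (intro mult_left_mono) auto
  moreover have "rate (Suc j) * bound c m j = 4 * q * (real (strength c j) * m)"
    using False rate_Suc[of j] rate_pos[of j] by (simp add: bound_def field_simps)
  ultimately show ?thesis by (simp add: algebra_simps)
qed

lemma M_ge: "50000 * (real L * real n * q) \<le> real M"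
  unfolding M_def by (simp add: of_nat_nat mult.assoc) linarith

lemma bound_final:
  assumes m: "m \<le> n" "m * min_degree c \<le> 16 * kap * n"
  shows "bound c m (r - 1) \<le> real M"
proof -
  have "Suc (r - 1) = r" using r_pos by simp
  then have "bound c m (r - 1) \<le> 20504 * (real L * real n * q)"
    using rate_bound[OF m, of "r - 1"] rate_r r_pos by simp
  also have "\<dots> \<le> 50000 * (real L * real n * q)" using q_ge_1 by (intro mult_right_mono) auto
  finally show ?thesis using M_ge by simp
qed

text \<open>The union bound needs a finite index set. Which arcs cross depends only on the
  partition, so every coarsening of \<open>s\<close> is represented by \<open>g \<circ> s\<close>
  with \<open>g\<close> from a finite function space.\<close>

lemma coarser_factor:
  fixes s :: "'a \<Rightarrow> 'b" and f :: "'a \<Rightarrow> 'c"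
  assumes "coarser V s f"
  obtains g where "g \<in> s ` V \<rightarrow>\<^sub>E V" "\<And>A. A \<subseteq> V \<times> V \<Longrightarrow> crossing f A = crossing (g \<circ> s) A"
proof
  define g where "g = restrict (\<lambda>y. inv_into V f (f (inv_into V s y))) (s ` V)"
  have gs: "g (s v) = inv_into V f (f v)" if "v \<in> V" for v
  proof -
    have "inv_into V s (s v) \<in> V" "s (inv_into V s (s v)) = s v"
      using that by (auto intro: inv_into_into f_inv_into_f)
    then have "f (inv_into V s (s v)) = f v" using assms that unfolding coarser_def by blast
    then show ?thesis using that by (simp add: g_def)
  qed
  have "inv_into V f (f v) \<in> V" if "v \<in> V" for v using that by (intro inv_into_into) auto
  then show "g \<in> s ` V \<rightarrow>\<^sub>E V" using gs by (auto simp: g_def)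
  fix A assume A: "A \<subseteq> V \<times> V"
  have "f u = f v \<longleftrightarrow> g (s u) = g (s v)" if "u \<in> V" "v \<in> V" for u v
    using gs that f_inv_into_f[of "f u" f V] f_inv_into_f[of "f v" f V] by (metis imageI)
  then show "crossing f A = crossing (g \<circ> s) A" using A unfolding crossing_def by auto
qed

lemma crossing_marked_card:
  assumes "j < r"
  shows "card (crossing f (marked E F j)) = card {i \<in> Pair j ` crossing f (edge_arcs E). F i \<in> {True}}"
proof -
  have "{i \<in> Pair j ` crossing f (edge_arcs E). F i \<in> {True}} = Pair j ` crossing f (marked E F j)"
    using assms by (auto simp: crossing_def marked_def)
  then show ?thesis by (simp add: card_image inj_on_def)
qed

lemma masks_tails:
  assumes G: "simple_graph V E" and j: "1 \<le> j" "j < r"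
  shows "measure_pmf.prob masks {F. k \<le> card (crossing f (marked E F j))}
      \<le> exp (rate j * card (crossing f (edge_arcs E))) / 2 ^ k"
    and "measure_pmf.prob masks {F. card (crossing f (marked E F j)) \<le> k}
      \<le> 2 ^ k * exp (- (rate j * card (crossing f (edge_arcs E)) / 2))"
proof -
  let ?A = "Pair j ` crossing f (edge_arcs E)"
  have sub: "?A \<subseteq> {1..<r} \<times> V \<times> V" using edge_arcs_subset[OF G] j by (auto simp: crossing_def)
  have card: "card ?A = card (crossing f (edge_arcs E))" by (simp add: card_image inj_on_def)
  have p: "measure_pmf.prob (bernoulli_pmf (rate (fst i))) {True} = rate j" if "i \<in> ?A" for i
    using that rate_pos[of j] rate_le_1[of j] j by (auto simp: measure_pmf_single)
  show "measure_pmf.prob masks {F. k \<le> card (crossing f (marked E F j))}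
      \<le> exp (rate j * card (crossing f (edge_arcs E))) / 2 ^ k"
    unfolding masks_def crossing_marked_card[OF j(2)] card[symmetric]
    by (rule prob_count_ge[OF _ sub p]) (use finV rate_pos[of j] in auto)
  show "measure_pmf.prob masks {F. card (crossing f (marked E F j)) \<le> k}
      \<le> 2 ^ k * exp (- (rate j * card (crossing f (edge_arcs E)) / 2))"
    unfolding masks_def crossing_marked_card[OF j(2)] card[symmetric]
    by (rule prob_count_le[OF _ sub p]) (use finV rate_pos[of j] rate_le_1[of j] j in auto)
qed

text \<open>Collects the hypotheses \<open>cut\<close>, \<open>sparse\<close> and
  \<open>small\<close> of \<open>trial_success\<close>, with \<open>bound\<close> in place of
  \<theta>.\<close>

definition good_masks ::
  "'a set set \<Rightarrow> 'a set \<Rightarrow> ('a \<Rightarrow> 'a) \<Rightarrow> (nat \<times> 'a \<times> 'a \<Rightarrow> bool) \<Rightarrow> bool" where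
  "good_masks E S s F \<longleftrightarrow> (\<forall>j f. 1 \<le> j \<longrightarrow> j < r \<longrightarrow>
     card (crossing (\<lambda>v. v \<in> S) (marked E F j)) < strength (cut_size E) j \<and>
     (coarser V s (f :: 'a \<Rightarrow> 'a) \<longrightarrow>
       (bound (cut_size E) (card (s ` V)) j < real (card (crossing f (edge_arcs E))) \<longrightarrow>
          strength (cut_size E) j * card (s ` V) < card (crossing f (marked E F j))) \<and>
       (real (card (crossing f (edge_arcs E))) \<le> bound (cut_size E) (card (s ` V)) (j - 1) \<longrightarrow>
          card (crossing f (marked E F j)) \<le> M)))"

text \<open>\<open>s\<close> is fixed while the masks are random, as the star labels come from
  independent coins. At each level there are three kinds of failure: too few samples, too many
  samples, too many samples across \<open>S\<close>.\<close>

lemma prob_good_masks: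
  fixes s :: "'a \<Rightarrow> 'a"
  assumes G: "simple_graph V E" and S: "cut_size E S \<le> min_degree (cut_size E)"
    and m: "m = card (s ` V)" "m * min_degree (cut_size E) \<le> 16 * kap * n"
  shows "1 / 2 \<le> measure_pmf.prob masks {F. good_masks E S s F}"
proof -
  let ?c = "cut_size E" and ?D = "edge_arcs E" and ?P = "measure_pmf.prob masks"
  \<comment> \<open>Three failures at each of at most \<open>L\<close> levels cost
    \<open>3 * L / 2 ^ (L + 3)\<close>, which is at most 3/8.\<close>
  define \<epsilon> :: real where "\<epsilon> = 1 / 2 ^ (L + 3)"
  have m_le: "m \<le> n" unfolding m(1) by (rule card_image_le[OF finV])
  have m_pos: "1 \<le> m" using V_nonempty finV unfolding m(1) by (simp add: Suc_le_eq card_gt_0_iff)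
  define \<G> where "\<G> = (s ` V \<rightarrow>\<^sub>E V)"
  have fin\<G>: "finite \<G>" unfolding \<G>_def using finV by (intro finite_PiE) auto
  have "card \<G> = n ^ m" unfolding \<G>_def using finV by (simp add: card_PiE m(1))
  also have "n ^ m \<le> (2 ^ L) ^ m" using n_le_pow by (intro power_mono) auto
  finally have "real (card \<G>) \<le> real ((2 ^ L) ^ m)" by (simp only: of_nat_le_iff)
  also have "\<dots> = 2 powr (real L * real m)"
    using powr_realpow[of 2 "L * m"] by (simp add: power_mult)
  finally have card\<G>: "real (card \<G>) \<le> 2 powr (real L * real m)" .
  define B1 where "B1 = (\<lambda>j (g :: 'a \<Rightarrow> 'a). if bound ?c m j < real (card (crossing (g \<circ> s) ?D))
     then {F. card (crossing (g \<circ> s) (marked E F j)) \<le> strength ?c j * m} else {})"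
  define B2 where "B2 = (\<lambda>j (g :: 'a \<Rightarrow> 'a). if real (card (crossing (g \<circ> s) ?D)) \<le> bound ?c m (j - 1)
     then {F. M \<le> card (crossing (g \<circ> s) (marked E F j))} else {})"
  define B3 where "B3 = (\<lambda>j. {F. strength ?c j \<le> card (crossing (\<lambda>v. v \<in> S) (marked E F j))})"
  have \<epsilon>_powr: "\<epsilon> = 2 powr (- (real L + 3))"
    unfolding powr_minus using powr_realpow[of 2 "L + 3"] by (simp add: \<epsilon>_def inverse_eq_divide)
  have union: "?P (\<Union>g\<in>\<G>. B g) \<le> \<epsilon>"
    if "\<And>g. g \<in> \<G> \<Longrightarrow> ?P (B g) \<le> 2 powr (- (real L * real m) - (real L + 3))" for B
  proof -
    have "?P (\<Union>g\<in>\<G>. B g) \<le> (\<Sum>g\<in>\<G>. ?P (B g))"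
      using fin\<G> by (intro measure_pmf.finite_measure_subadditive_finite) auto
    also have "\<dots> \<le> (\<Sum>g\<in>\<G>. 2 powr (- (real L * real m) - (real L + 3)))" using that by (intro sum_mono)
    also have "\<dots> \<le> 2 powr (real L * real m) * 2 powr (- (real L * real m) - (real L + 3))"
      using card\<G> by (simp add: mult_right_mono)
    also have "\<dots> = \<epsilon>" by (simp add: powr_add[symmetric] \<epsilon>_powr)
    finally show ?thesis .
  qed
  have 1: "?P (\<Union>g\<in>\<G>. B1 j g) \<le> \<epsilon>" if j: "1 \<le> j" "j < r" for j
  proof (rule union)
    fix g assume "g \<in> \<G>"
    show "?P (B1 j g) \<le> 2 powr (- (real L * real m) - (real L + 3))"
    proof (cases "bound ?c m j < real (card (crossing (g \<circ> s) ?D))")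
      case True
      define x where "x = real (strength ?c j) * real m"
      have x0: "0 \<le> x" by (simp add: x_def)
      have "4 * x = rate j * bound ?c m j" using j rate_pos[of j] by (simp add: bound_def x_def)
      also have "\<dots> \<le> rate j * real (card (crossing (g \<circ> s) ?D))"
        using True rate_pos[of j] by (intro mult_left_mono) auto
      finally have le: "- (rate j * real (card (crossing (g \<circ> s) ?D)) / 2) \<le> - (2 * x)" by simp
      have "?P (B1 j g) \<le> 2 ^ (strength ?c j * m) * exp (- (rate j * real (card (crossing (g \<circ> s) ?D)) / 2))"
        using True masks_tails(2)[OF G j] by (simp add: B1_def)
      also have "\<dots> \<le> 2 ^ (strength ?c j * m) * exp (- (2 * x))"
        using le by (intro mult_left_mono) auto
      also have "\<dots> \<le> 2 ^ (strength ?c j * m) * 2 powr (- (2 * x))"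
        using exp_minus_le_2_powr[of "2 * x"] x0 by (intro mult_left_mono) auto
      also have "\<dots> = 2 powr (- x)" by (simp add: powr_realpow[symmetric] x_def powr_add[symmetric] mult.commute)
      also have "\<dots> \<le> 2 powr (- (real L * real m) - (real L + 3))"
      proof -
        \<comment> \<open>\<open>L * m\<close> absorbs the number of labelings; the remaining
          \<open>(L + 3) * m\<close> is at least \<open>L + 3\<close> because there is a
          class.\<close>
        have "(2 * real L + 3) * real m \<le> x" unfolding x_def
          using strength_ge[of ?c j] rate_pos[of j]
          by (intro mult_right_mono) (auto intro: order_trans[rotated])
        moreover have "(real L + 3) * 1 \<le> (real L + 3) * real m" using m_pos by (intro mult_left_mono) auto
        ultimately show ?thesis by (intro powr_mono) (auto simp: algebra_simps)
      qed
      finally show ?thesis .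
    qed (simp add: B1_def)
  qed
  have 2: "?P (\<Union>g\<in>\<G>. B2 j g) \<le> \<epsilon>" if j: "1 \<le> j" "j < r" for j
  proof (rule union)
    fix g assume "g \<in> \<G>"
    show "?P (B2 j g) \<le> 2 powr (- (real L * real m) - (real L + 3))"
    proof (cases "real (card (crossing (g \<circ> s) ?D)) \<le> bound ?c m (j - 1)")
      case True
      define x where "x = rate j * real (card (crossing (g \<circ> s) ?D))"
      have x0: "0 \<le> x" using rate_pos[of j] by (simp add: x_def)
      have "x \<le> rate j * bound ?c m (j - 1)" unfolding x_def
        using True rate_pos[of j] by (intro mult_left_mono) auto
      also have "\<dots> \<le> 20504 * (real L * real n * q)"
        using rate_bound[OF m_le m(2), of "j - 1"] j by simp
      finally have x: "x \<le> 20504 * (real L * real n * q)" .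
      have "?P (B2 j g) \<le> exp x / 2 ^ M"
        using True masks_tails(1)[OF G j] by (simp add: B2_def x_def)
      also have "\<dots> \<le> 2 powr (2 * x) / 2 ^ M"
        using exp_le_4_powr[OF x0] by (intro divide_right_mono) auto
      also have "\<dots> = 2 powr (2 * x - real M)" by (simp add: powr_diff powr_realpow)
      also have "\<dots> \<le> 2 powr (- (real L * real m) - (real L + 3))"
      proof -
        have "real L * real m \<le> real L * real n * 1" using m_le by (simp add: mult_left_mono)
        also have "\<dots> \<le> real L * real n * q" using q_ge_1 by (intro mult_left_mono) auto
        finally have a: "real L * real m \<le> real L * real n * q" .
        have "real L * 1 * 1 \<le> real L * real n * q" using n_ge_2 q_ge_1 by (intro mult_mono) auto
        moreover have "real L + 3 \<le> 4 * real L" using L_pos by simp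
        ultimately have "real L + 3 \<le> 4 * (real L * real n * q)" by linarith
        \<comment> \<open>Here 50000 - 2 * 20504 leaves far more than the 5 multiples of
          \<open>L * n * q\<close> required.\<close>
        with a x M_ge have "2 * x - real M \<le> - (real L * real m) - (real L + 3)" by linarith
        then show ?thesis by (intro powr_mono) auto
      qed
      finally show ?thesis .
    qed (simp add: B2_def)
  qed
  have 3: "?P (B3 j) \<le> \<epsilon>" if j: "1 \<le> j" "j < r" for j
  proof -
    define x where "x = rate j * real (card (crossing (\<lambda>v. v \<in> S) ?D))"
    have x0: "0 \<le> x" using rate_pos[of j] by (simp add: x_def)
    have "x \<le> rate j * (2 * real (min_degree ?c))" unfolding x_def card_crossing_set[OF G]
      using S rate_pos[of j] by (intro mult_left_mono) auto
    moreover have "0 \<le> rate j * real (min_degree ?c)" using rate_pos[of j] by simp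
    ultimately have x: "2 * x \<le> 8 * real (min_degree ?c) * rate j" by (simp add: mult.commute)
    have "?P (B3 j) \<le> exp x / 2 ^ strength ?c j"
      using masks_tails(1)[OF G j] by (simp add: B3_def x_def)
    also have "\<dots> \<le> 2 powr (2 * x) / 2 ^ strength ?c j"
      using exp_le_4_powr[OF x0] by (intro divide_right_mono) auto
    also have "\<dots> = 2 powr (2 * x - real (strength ?c j))" by (simp add: powr_diff powr_realpow)
    also have "\<dots> \<le> \<epsilon>" unfolding \<epsilon>_powr
    proof (rule powr_mono)
      show "2 * x - real (strength ?c j) \<le> - (real L + 3)" using x strength_ge[of ?c j] by (simp add: mult.commute mult.left_commute)
    qed simp
    finally show ?thesis .
  qed
  define Bad where "Bad = (\<Union>j\<in>{1..<r}. (\<Union>g\<in>\<G>. B1 j g) \<union> (\<Union>g\<in>\<G>. B2 j g) \<union> B3 j)"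
  have "?P Bad \<le> (\<Sum>j\<in>{1..<r}. ?P ((\<Union>g\<in>\<G>. B1 j g) \<union> (\<Union>g\<in>\<G>. B2 j g) \<union> B3 j))"
    unfolding Bad_def by (intro measure_pmf.finite_measure_subadditive_finite) auto
  also have "\<dots> \<le> (\<Sum>j\<in>{1..<r}. 3 * \<epsilon>)"
  proof (intro sum_mono)
    fix j assume j: "j \<in> {1..<r}"
    have "?P ((\<Union>g\<in>\<G>. B1 j g) \<union> (\<Union>g\<in>\<G>. B2 j g) \<union> B3 j)
      \<le> ?P (\<Union>g\<in>\<G>. B1 j g) + ?P (\<Union>g\<in>\<G>. B2 j g) + ?P (B3 j)"
      by (intro order_trans[OF measure_Un_le] add_right_mono measure_Un_le) auto
    then show "?P ((\<Union>g\<in>\<G>. B1 j g) \<union> (\<Union>g\<in>\<G>. B2 j g) \<union> B3 j) \<le> 3 * \<epsilon>"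
      using 1[of j] 2[of j] 3[of j] j by simp
  qed
  also have "\<dots> \<le> real L * (3 * \<epsilon>)"
  proof -
    have "real (r - 1) \<le> real L" using r_le_log unfolding L_def by linarith
    then have "real (r - 1) * (3 * \<epsilon>) \<le> real L * (3 * \<epsilon>)"
      by (intro mult_right_mono) (simp_all add: \<epsilon>_def)
    then show ?thesis by simp
  qed
  also have "\<dots> \<le> 1 / 2"
  proof -
    have "real L / 2 ^ L \<le> 1" by (simp add: less_imp_le)
    moreover have "real L * (3 * \<epsilon>) = 3 / 8 * (real L / 2 ^ L)" by (simp add: \<epsilon>_def power_add)
    ultimately show ?thesis by linarith
  qed
  finally have "?P Bad \<le> 1 / 2" .
  moreover have "- {F. good_masks E S s F} \<subseteq> Bad"
  proof
    fix F assume "F \<in> - {F. good_masks E S s F}"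
    then have "\<not> good_masks E S s F" by simp
    then obtain j f where j: "1 \<le> j" "j < r" and "\<not> (card (crossing (\<lambda>v. v \<in> S) (marked E F j)) < strength ?c j \<and>
     (coarser V s (f :: 'a \<Rightarrow> 'a) \<longrightarrow>
       (bound ?c m j < real (card (crossing f ?D)) \<longrightarrow> strength ?c j * m < card (crossing f (marked E F j))) \<and>
       (real (card (crossing f ?D)) \<le> bound ?c m (j - 1) \<longrightarrow> card (crossing f (marked E F j)) \<le> M)))"
      unfolding good_masks_def m(1) by blast
    then consider "F \<in> B3 j" | "coarser V s f" "bound ?c m j < real (card (crossing f ?D))"
        "card (crossing f (marked E F j)) \<le> strength ?c j * m"
      | "coarser V s f" "real (card (crossing f ?D)) \<le> bound ?c m (j - 1)"
        "M \<le> card (crossing f (marked E F j))"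
      unfolding B3_def by (auto simp: not_less not_le)
    then have "F \<in> B3 j \<or> (\<exists>g\<in>\<G>. F \<in> B1 j g) \<or> (\<exists>g\<in>\<G>. F \<in> B2 j g)"
    proof cases
      case 2
      then obtain g where g: "g \<in> \<G>" "\<And>A. A \<subseteq> V \<times> V \<Longrightarrow> crossing f A = crossing (g \<circ> s) A"
        using coarser_factor[of s f] unfolding \<G>_def by blast
      have "crossing f ?D = crossing (g \<circ> s) ?D" "crossing f (marked E F j) = crossing (g \<circ> s) (marked E F j)"
        using edge_arcs_subset[OF G] by (auto intro!: g(2) simp: marked_def)
      then show ?thesis using 2 g(1) by (auto simp: B1_def)
    next
      case 3
      then obtain g where g: "g \<in> \<G>" "\<And>A. A \<subseteq> V \<times> V \<Longrightarrow> crossing f A = crossing (g \<circ> s) A"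
        using coarser_factor[of s f] unfolding \<G>_def by blast
      have "crossing f ?D = crossing (g \<circ> s) ?D" "crossing f (marked E F j) = crossing (g \<circ> s) (marked E F j)"
        using edge_arcs_subset[OF G] by (auto intro!: g(2) simp: marked_def)
      then show ?thesis using 3 g(1) by (auto simp: B2_def)
    qed simp
    then show "F \<in> Bad" using j unfolding Bad_def by auto
  qed
  ultimately have "?P (- {F. good_masks E S s F}) \<le> 1 / 2"
    using measure_pmf.finite_measure_mono[of "- {F. good_masks E S s F}" Bad masks] by simp
  from prob_ge_one_minus[OF this] show ?thesis by simp
qed

end

text \<open>From \<open>1 / y \<le> exp (1 / y - 1)\<close> and
  \<open>1 / y - 1 = (1 - y) / y\<close>. It turns a product of probabilities of staying on one's
  side into the exponential of a sum of crossing fractions.\<close>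

lemma exp_le_of_ge:
  fixes y :: real
  assumes "1 / 64 \<le> y" "y \<le> 1"
  shows "exp (- (64 * (1 - y))) \<le> y"
proof -
  have "1 + (1 / y - 1) \<le> exp (1 / y - 1)" by (rule exp_ge_add_one_self)
  then have "1 / y \<le> exp (1 / y - 1)" by simp
  moreover have "1 / y - 1 \<le> 64 * (1 - y)"
  proof -
    have "1 / y - 1 = (1 - y) * (1 / y)" using assms by (simp add: field_simps)
    also have "\<dots> \<le> (1 - y) * 64" using assms by (intro mult_left_mono) (auto simp: field_simps)
    finally show ?thesis by simp
  qed
  ultimately have "1 / y \<le> exp (64 * (1 - y))" by (meson exp_le_cancel_iff order_trans)
  then have "1 / exp (64 * (1 - y)) \<le> y" using assms by (simp add: field_simps)
  then show ?thesis unfolding exp_minus inverse_eq_divide .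
qed

context cut_setting
begin

subsection \<open>Star contraction\<close>

definition hashes :: "('a \<Rightarrow> nat) pmf" where
  "hashes = Pi_pmf V 0 (\<lambda>_. pmf_of_set {..<n})"

definition choices :: "('a \<times> 'a set \<Rightarrow> 'a) pmf" where
  "choices = Pi_pmf (V \<times> (Pow V - {{}})) undefined (\<lambda>x. pmf_of_set (snd x))"

definition hits :: "'a set set \<Rightarrow> ('a \<Rightarrow> nat) \<Rightarrow> 'a \<Rightarrow> 'a set" where
  "hits E h v = {u \<in> nbrs E v. h u < threshold (cut_size E {v})}"

lemma hits_eq: "simple_graph V E \<Longrightarrow> nbrs E v \<inter> centers h (cut_size E) v = hits E h v"
  using nbrs_subset[of V E v] not_self_nbr[of v E] by (auto simp: hits_def centers_def)

lemma min_degree_le: "v \<in> V \<Longrightarrow> min_degree c \<le> c {v}"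
  unfolding min_degree_def using finV by (intro Min_le) auto

lemma degree_le_n:
  assumes "simple_graph V E" "v \<in> V"
  shows "cut_size E {v} \<le> n"
  unfolding cut_size_singleton[OF assms] by (rule card_mono[OF finV nbrs_subset[OF assms(1)]])

text \<open>Rounding up costs at most a factor 2, since \<open>n * kap / d\<close> is at least
  1.\<close>

lemma threshold_bounds:
  assumes d: "kap \<le> d" "d \<le> n"
  shows "threshold d \<le> n" "real kap / real d \<le> real (threshold d) / real n"
    "real (threshold d) / real n \<le> 2 * real kap / real d"
proof -
  have kap: "1 \<le> kap" using L_pos by (simp add: kap_def)
  have d0: "0 < real d" using d kap by simp
  let ?x = "real n * real kap / real d"
  have x1: "1 \<le> ?x"
  proof -
    have "real d * 1 \<le> real n * real kap" using d kap by (intro mult_mono) auto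
    then show ?thesis using d0 by (simp add: field_simps)
  qed
  have xn: "?x \<le> real n" using d d0 by (simp add: field_simps mult_left_mono)
  have t: "?x \<le> real (threshold d)" "real (threshold d) \<le> ?x + 1"
    using x1 unfolding threshold_def by linarith+
  show "threshold d \<le> n"
  proof -
    have "\<lceil>?x\<rceil> \<le> int n" using xn by (simp add: ceiling_le_iff)
    then show ?thesis unfolding threshold_def by linarith
  qed
  have n0: "0 < real n" using n_ge_2 by simp
  show "real kap / real d \<le> real (threshold d) / real n" using t(1) n0 by (simp add: field_simps)
  have "real (threshold d) / real n \<le> (2 * ?x) / real n" using t(2) x1 n0 by (intro divide_right_mono) auto
  also have "\<dots> = 2 * real kap / real d" using n0 by simp
  finally show "real (threshold d) / real n \<le> 2 * real kap / real d" .
qed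

lemma threshold_antimono: "0 < d \<Longrightarrow> d \<le> d' \<Longrightarrow> threshold d' \<le> threshold d"
  unfolding threshold_def by (intro nat_mono ceiling_mono divide_left_mono) auto

lemma prob_below: "t \<le> n \<Longrightarrow> measure_pmf.prob (pmf_of_set {..<n}) {..<t} = real t / real n"
proof -
  assume "t \<le> n"
  then have "{..<n} \<inter> {..<t} = {..<t}" by auto
  moreover have "{..<n} \<noteq> {}" using n_ge_2 by (auto simp: lessThan_empty_iff)
  ultimately show ?thesis by (simp add: measure_pmf_of_set)
qed

lemma prob_hash_below:
  assumes "u \<in> V" "t \<le> n"
  shows "measure_pmf.prob hashes {h. h u < t} = real t / real n"
proof -
  have "measure_pmf.prob hashes {h. h u < t} = measure_pmf.prob (map_pmf (\<lambda>h. h u) hashes) {..<t}"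
    by (simp add: vimage_def)
  also have "map_pmf (\<lambda>h. h u) hashes = pmf_of_set {..<n}"
    using assms(1) Pi_pmf_component[OF finV, of u 0 "\<lambda>_. pmf_of_set {..<n}"] by (simp add: hashes_def)
  finally show ?thesis using prob_below[OF assms(2)] by simp
qed

text \<open>The upper bound on hits makes recovery exact; with the lower bound on same-side hits, a
  pick stays on its side with probability at least 1/64. The third condition bounds the sum of all
  crossing fractions, the last one the number of classes.\<close>

definition good_hash :: "'a set set \<Rightarrow> 'a set \<Rightarrow> ('a \<Rightarrow> nat) \<Rightarrow> bool" where
  "good_hash E S h \<longleftrightarrow>
     (\<forall>v\<in>V. card (hits E h v) \<le> 8 * kap \<and> 5 * L \<le> card {u \<in> hits E h v. (u \<in> S) = (v \<in> S)}) \<and>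
     card {(v, u) \<in> crossing (\<lambda>v. v \<in> S) (edge_arcs E). u \<in> hits E h v} \<le> 32 * kap \<and>
     card {u \<in> V. h u < threshold (min_degree (cut_size E))} * min_degree (cut_size E) \<le> 16 * kap * n"

text \<open>Four failures of probability at most 1/8 each: two by exponential tails and a union over
  the vertices, two by Markov's inequality.\<close>

lemma prob_good_hash:
  assumes G: "simple_graph V E" and S: "is_min_cut V E S" and lt: "cut_size E S < min_degree (cut_size E)"
    and kap: "kap \<le> min_degree (cut_size E)"
  shows "1 / 2 \<le> measure_pmf.prob hashes {h. good_hash E S h}"
proof -
  let ?P = "measure_pmf.prob hashes" and ?\<delta> = "min_degree (cut_size E)"
  define d where "d = (\<lambda>v. cut_size E {v})"
  define \<rho> where "\<rho> = (\<lambda>v. real (threshold (d v)) / real n)"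
  have kap_pos: "1 \<le> kap" using L_pos by (simp add: kap_def)
  have n0: "0 < real n" using n_ge_2 by simp
  have d: "kap \<le> d v" "d v \<le> n" "?\<delta> \<le> d v" "d v = card (nbrs E v)" if "v \<in> V" for v
    using that kap min_degree_le[OF that, of "cut_size E"] degree_le_n[OF G that] cut_size_singleton[OF G that]
    by (auto simp: d_def)
  note t = threshold_bounds[OF d(1,2)]
  obtain v0 where v0: "v0 \<in> V" using V_nonempty by blast
  have \<delta>: "kap \<le> ?\<delta>" "?\<delta> \<le> n" "0 < ?\<delta>" using kap d(2,3)[OF v0] kap_pos by auto
  have \<rho>: "0 \<le> \<rho> v" "\<rho> v \<le> 1" "real kap \<le> \<rho> v * real (d v)" "\<rho> v * real (d v) \<le> 2 * real kap"
    if v: "v \<in> V" for v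
  proof -
    have dv: "0 < real (d v)" using d(1)[OF v] kap_pos by simp
    show "0 \<le> \<rho> v" "\<rho> v \<le> 1" using t(1)[OF v v] n0 by (auto simp: \<rho>_def)
    show "real kap \<le> \<rho> v * real (d v)" using t(2)[OF v v] dv by (simp add: \<rho>_def pos_divide_le_eq)
    show "\<rho> v * real (d v) \<le> 2 * real kap" using t(3)[OF v v] dv by (simp add: \<rho>_def pos_le_divide_eq)
  qed
  have p: "measure_pmf.prob (pmf_of_set {..<n}) {..<threshold (d v)} = \<rho> v" if "v \<in> V" for v
    using prob_below[OF t(1)[OF that that]] by (simp add: \<rho>_def)
  define Ba where "Ba = (\<lambda>v. {h. 8 * kap \<le> card {u \<in> nbrs E v. h u \<in> {..<threshold (d v)}}})"
  define N where "N = (\<lambda>v. {u \<in> nbrs E v. (u \<in> S) = (v \<in> S)})"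
  define Bb where "Bb = (\<lambda>v. {h. card {u \<in> N v. h u \<in> {..<threshold (d v)}} \<le> 5 * L})"
  define J where "J = crossing (\<lambda>v. v \<in> S) (edge_arcs E)"
  define Bc where "Bc = {h. real (32 * kap) \<le> real (card {j \<in> J. h \<in> {h. h (snd j) < threshold (d (fst j))}})}"
  define Bd where "Bd = {h. 16 * real kap * real n / real ?\<delta> \<le> real (card {u \<in> V. h \<in> {h. h u < threshold ?\<delta>}})}"
  define \<eta> :: real where "\<eta> = 1 / (8 * real n)"
  have \<eta>: "2 powr (- (real L + 3)) \<le> \<eta>"
  proof -
    have "8 * real n \<le> 2 powr (real L + 3)"
    proof -
      have "real n \<le> real (2 ^ L)" using n_le_pow by (simp only: of_nat_le_iff)
      then show ?thesis by (simp add: powr_add powr_realpow)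
    qed
    then have "1 / 2 powr (real L + 3) \<le> 1 / (8 * real n)" using n0 by (intro divide_left_mono) auto
    then show ?thesis unfolding powr_minus \<eta>_def by (simp add: inverse_eq_divide)
  qed
  have a: "?P (Ba v) \<le> \<eta>" if v: "v \<in> V" for v
  proof -
    have "?P (Ba v) \<le> exp (\<rho> v * real (card (nbrs E v))) / 2 ^ (8 * kap)"
      unfolding Ba_def hashes_def
      by (rule prob_count_ge[OF finV nbrs_subset[OF G]]) (use p[OF v] \<rho>[OF v] in auto)
    also have "\<dots> \<le> exp (2 * real kap) / 2 ^ (8 * kap)"
      using \<rho>(4)[OF v] by (intro divide_right_mono) (auto simp: d(4)[OF v])
    also have "\<dots> \<le> 2 powr (2 * (2 * real kap)) / 2 ^ (8 * kap)"
      by (intro divide_right_mono exp_le_4_powr) auto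
    also have "\<dots> = 2 powr (- 4 * real kap)"
      using powr_realpow[of 2 "8 * kap"] by (simp add: powr_diff[symmetric] flip: powr_realpow)
    also have "\<dots> \<le> 2 powr (- (real L + 3))" using L_pos by (intro powr_mono) (auto simp: kap_def)
    finally show ?thesis using \<eta> by simp
  qed
  have b: "?P (Bb v) \<le> \<eta>" if v: "v \<in> V" for v
  proof -
    have half: "2 * card {u \<in> nbrs E v. (u \<in> S) \<noteq> (v \<in> S)} \<le> card (nbrs E v)"
    proof (rule crossing_nbrs_le_half[OF G S _ v])
      fix w assume "w \<in> V"
      then show "cut_size E S < card (nbrs E w)" using lt d(3,4)[of w] by simp
    qed
    have "card (nbrs E v) = card (N v \<union> {u \<in> nbrs E v. (u \<in> S) \<noteq> (v \<in> S)})"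
      by (intro arg_cong[where f = card]) (auto simp: N_def)
    also have "\<dots> \<le> card (N v) + card {u \<in> nbrs E v. (u \<in> S) \<noteq> (v \<in> S)}" by (rule card_Un_le)
    finally have N: "card (nbrs E v) \<le> 2 * card (N v)" using half by simp
    have NV: "N v \<subseteq> V" using nbrs_subset[OF G] by (auto simp: N_def)
    have "\<rho> v * real (d v) \<le> \<rho> v * (2 * real (card (N v)))"
      using N d(4)[OF v] \<rho>(1)[OF v] by (intro mult_left_mono) auto
    \<comment> \<open>At least half of the neighbours are on the side of \<open>v\<close>, so at
      least \<open>kap / 2 = 20 * L\<close> same-side hits are expected; 5 * \<open>L\<close> is a
      quarter of this.\<close>
    then have "10 * real L \<le> \<rho> v * real (card (N v)) / 2"
      using \<rho>(3)[OF v] by (simp add: kap_def)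
    then have le: "- (\<rho> v * real (card (N v)) / 2) \<le> - (10 * real L)" by simp
    have "?P (Bb v) \<le> 2 ^ (5 * L) * exp (- (\<rho> v * real (card (N v)) / 2))"
      unfolding Bb_def hashes_def
      by (rule prob_count_le[OF finV NV]) (use p[OF v] \<rho>[OF v] in auto)
    also have "\<dots> \<le> 2 ^ (5 * L) * exp (- (10 * real L))"
      using le by (intro mult_left_mono) auto
    also have "\<dots> \<le> 2 ^ (5 * L) * 2 powr (- (10 * real L))"
      by (intro mult_left_mono exp_minus_le_2_powr) auto
    also have "\<dots> = 2 powr (- 5 * real L)"
      using powr_realpow[of 2 "5 * L"] by (simp add: powr_add[symmetric] flip: powr_realpow)
    also have "\<dots> \<le> 2 powr (- (real L + 3))" using L_pos by (intro powr_mono) auto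
    finally show ?thesis using \<eta> by simp
  qed
  have finJ: "finite J" unfolding J_def
    using finite_edge_arcs[OF G] by (rule finite_subset[rotated]) (auto simp: crossing_def)
  have JV: "J \<subseteq> V \<times> V" using edge_arcs_subset[OF G] by (auto simp: J_def crossing_def)
  have c: "?P Bc \<le> 1 / 8"
  proof -
    \<comment> \<open>\<open>J\<close> has two arcs per cut edge, so fewer than
      \<open>2 * ?\<delta>\<close>, each hit with probability at most
      \<open>2 * kap / ?\<delta>\<close>: an expectation of at most \<open>4 * kap\<close>.\<close>
    have "(\<Sum>j\<in>J. ?P {h. h (snd j) < threshold (d (fst j))}) \<le> (\<Sum>j\<in>J. 2 * real kap / real ?\<delta>)"
    proof (intro sum_mono)
      fix j assume "j \<in> J"
      then have j: "fst j \<in> V" "snd j \<in> V" using JV by auto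
      have "?P {h. h (snd j) < threshold (d (fst j))} = \<rho> (fst j)"
        using prob_hash_below[OF j(2) t(1)[OF j(1) j(1)]] by (simp add: \<rho>_def)
      also have "\<dots> \<le> 2 * real kap / real (d (fst j))" using t(3)[OF j(1) j(1)] by (simp add: \<rho>_def)
      also have "\<dots> \<le> 2 * real kap / real ?\<delta>"
        using d(3)[OF j(1)] \<delta>(3) by (intro divide_left_mono) auto
      finally show "?P {h. h (snd j) < threshold (d (fst j))} \<le> 2 * real kap / real ?\<delta>" .
    qed
    also have "\<dots> = 2 * real (cut_size E S) * (2 * real kap / real ?\<delta>)"
      using card_crossing_set[OF G] by (simp add: J_def)
    also have "\<dots> \<le> 2 * real ?\<delta> * (2 * real kap / real ?\<delta>)"
      using lt by (intro mult_right_mono) auto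
    also have "\<dots> = 4 * real kap" using \<delta>(3) by simp
    finally have "?P Bc \<le> 4 * real kap / real (32 * kap)"
      unfolding Bc_def by (intro prob_card_ge_markov[OF finJ]) (use kap_pos in auto)
    then show ?thesis using kap_pos by simp
  qed
  have dd: "?P Bd \<le> 1 / 8"
  proof -
    have "(\<Sum>u\<in>V. ?P {h. h u < threshold ?\<delta>}) = real n * (real (threshold ?\<delta>) / real n)"
      using prob_hash_below[OF _ threshold_bounds(1)[OF \<delta>(1,2)]] by simp
    also have "\<dots> \<le> real n * (2 * real kap / real ?\<delta>)"
      using threshold_bounds(3)[OF \<delta>(1,2)] by (intro mult_left_mono) auto
    finally have "?P Bd \<le> real n * (2 * real kap / real ?\<delta>) / (16 * real kap * real n / real ?\<delta>)"
      unfolding Bd_def by (intro prob_card_ge_markov[OF finV]) (use kap_pos \<delta>(3) n0 in auto)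
    also have "\<dots> = 1 / 8" using kap_pos \<delta>(3) n0 by (simp add: field_simps)
    finally show ?thesis .
  qed
  have unionV: "?P (\<Union>v\<in>V. B v) \<le> 1 / 8" if "\<And>v. v \<in> V \<Longrightarrow> ?P (B v) \<le> \<eta>" for B
  proof -
    have "?P (\<Union>v\<in>V. B v) \<le> (\<Sum>v\<in>V. ?P (B v))"
      using finV by (intro measure_pmf.finite_measure_subadditive_finite) auto
    also have "\<dots> \<le> (\<Sum>v\<in>V. \<eta>)" using that by (intro sum_mono)
    also have "\<dots> = 1 / 8" using n0 by (simp add: \<eta>_def)
    finally show ?thesis .
  qed
  define Bad where "Bad = (\<Union>v\<in>V. Ba v) \<union> (\<Union>v\<in>V. Bb v) \<union> (Bc \<union> Bd)"
  have "?P Bad \<le> (?P (\<Union>v\<in>V. Ba v) + ?P (\<Union>v\<in>V. Bb v)) + (?P Bc + ?P Bd)"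
    unfolding Bad_def by (intro order_trans[OF measure_Un_le] add_mono measure_Un_le) auto
  then have "?P Bad \<le> 1 / 2" using unionV[of Ba, OF a] unionV[of Bb, OF b] c dd by simp
  moreover have "- {h. good_hash E S h} \<subseteq> Bad"
  proof
    fix h assume "h \<in> - {h. good_hash E S h}"
    then have bad: "\<not> good_hash E S h" by simp
    show "h \<in> Bad"
    proof (rule ccontr)
      assume nb: "h \<notin> Bad"
      have hits: "hits E h v = {u \<in> nbrs E v. h u \<in> {..<threshold (d v)}}"
        "{u \<in> hits E h v. (u \<in> S) = (v \<in> S)} = {u \<in> N v. h u \<in> {..<threshold (d v)}}" for v
        by (auto simp: hits_def d_def N_def)
      have "card (hits E h v) \<le> 8 * kap" if "v \<in> V" for v
        using nb that unfolding hits(1) by (auto simp: Bad_def Ba_def)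
      moreover have "5 * L \<le> card {u \<in> hits E h v. (u \<in> S) = (v \<in> S)}" if "v \<in> V" for v
        using nb that unfolding hits(2) by (auto simp: Bad_def Bb_def)
      moreover have "card {(v, u) \<in> crossing (\<lambda>v. v \<in> S) (edge_arcs E). u \<in> hits E h v} \<le> 32 * kap"
      proof -
        have "{(v, u) \<in> crossing (\<lambda>v. v \<in> S) (edge_arcs E). u \<in> hits E h v}
            = {j \<in> J. h \<in> {h. h (snd j) < threshold (d (fst j))}}"
          by (auto simp: J_def hits_def d_def crossing_def edge_arcs_def)
        moreover have "h \<notin> Bc" using nb by (simp add: Bad_def)
        ultimately show ?thesis unfolding Bc_def by (simp add: not_le del: of_nat_mult)
      qed
      moreover have "card {u \<in> V. h u < threshold ?\<delta>} * ?\<delta> \<le> 16 * kap * n"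
      proof -
        have "real (card {u \<in> V. h u < threshold ?\<delta>}) < 16 * real kap * real n / real ?\<delta>"
          using nb by (simp add: Bad_def Bd_def not_le)
        then have "real (card {u \<in> V. h u < threshold ?\<delta>} * ?\<delta>) < real (16 * kap * n)"
          using \<delta>(3) by (simp add: field_simps)
        then show ?thesis by (simp only: of_nat_less_iff less_imp_le)
      qed
      ultimately show False using bad unfolding good_hash_def by blast
    qed
  qed
  ultimately have "?P (- {h. good_hash E S h}) \<le> 1 / 2"
    using measure_pmf.finite_measure_mono[of "- {h. good_hash E S h}" Bad hashes] by simp
  from prob_ge_one_minus[OF this] show ?thesis by simp
qed

text \<open>Only the coordinates \<open>(v, X v)\<close> are constrained, one for each
  \<open>v\<close>; all other factors of the product measure are 1.\<close>

lemma prob_choices: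
  assumes X: "\<And>v. v \<in> V \<Longrightarrow> X v \<subseteq> V \<and> X v \<noteq> {}" and Y: "\<And>v. v \<in> V \<Longrightarrow> Y v \<subseteq> X v"
  shows "measure_pmf.prob choices {g. \<forall>v\<in>V. g (v, X v) \<in> Y v} = (\<Prod>v\<in>V. real (card (Y v)) / real (card (X v)))"
proof -
  let ?I = "V \<times> (Pow V - {{}})"
  define B where "B = (\<lambda>x. if snd x = X (fst x) then Y (fst x) else UNIV)"
  have fin: "finite ?I" using finV by auto
  have "{g. \<forall>v\<in>V. g (v, X v) \<in> Y v} = Pi ?I B"
  proof (intro equalityI subsetI)
    fix g assume "g \<in> {g. \<forall>v\<in>V. g (v, X v) \<in> Y v}"
    then show "g \<in> Pi ?I B" by (auto simp: B_def split: if_splits)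
  next
    fix g assume g: "g \<in> Pi ?I B"
    have "g (v, X v) \<in> Y v" if v: "v \<in> V" for v
      using Pi_mem[OF g, of "(v, X v)"] X[OF v] v by (simp add: B_def)
    then show "g \<in> {g. \<forall>v\<in>V. g (v, X v) \<in> Y v}" by blast
  qed
  then have "measure_pmf.prob choices {g. \<forall>v\<in>V. g (v, X v) \<in> Y v}
      = (\<Prod>x\<in>?I. measure_pmf.prob (pmf_of_set (snd x)) (B x))"
    unfolding choices_def by (simp only: measure_Pi_pmf_Pi[OF fin])
  also have "\<dots> = (\<Prod>x\<in>(\<lambda>v. (v, X v)) ` V. measure_pmf.prob (pmf_of_set (snd x)) (B x))"
    by (rule prod.mono_neutral_right[OF fin]) (use X in \<open>auto simp: B_def\<close>)
  also have "\<dots> = (\<Prod>v\<in>V. measure_pmf.prob (pmf_of_set (X v)) (Y v))"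
    by (subst prod.reindex) (auto simp: inj_on_def B_def)
  also have "\<dots> = (\<Prod>v\<in>V. real (card (Y v)) / real (card (X v)))"
  proof (intro prod.cong refl)
    fix v assume v: "v \<in> V"
    have "X v \<inter> Y v = Y v" using Y[OF v] by auto
    moreover have "finite (X v)" using X[OF v] finV finite_subset by auto
    ultimately show "measure_pmf.prob (pmf_of_set (X v)) (Y v) = real (card (Y v)) / real (card (X v))"
      using X[OF v] by (simp add: measure_pmf_of_set)
  qed
  finally show ?thesis .
qed

definition good_star :: "'a set set \<Rightarrow> 'a set \<Rightarrow> ('a \<Rightarrow> 'a) \<Rightarrow> bool" where
  "good_star E S s \<longleftrightarrow> coarser V s (\<lambda>v. v \<in> S) \<and> card (s ` V) * min_degree (cut_size E) \<le> 16 * kap * n"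

text \<open>Vertex \<open>v\<close> stays on its side with probability
  \<open>1 - card (Z v) / card (X v)\<close>. The product over all vertices is at least the
  exponential of -64 times the sum of \<open>card (Z v) / (5 * L)\<close>; that sum is at most
  \<open>32 * kap / (5 * L) = 256\<close>, and 64 * 256 = 16384.\<close>

lemma prob_good_choices:
  assumes G: "simple_graph V E" and h: "good_hash E S h" and kap: "kap \<le> min_degree (cut_size E)"
  shows "exp (- 16384) \<le> measure_pmf.prob choices {g. good_star E S (star h g (cut_size E))}"
proof -
  let ?P = "measure_pmf.prob choices" and ?\<delta> = "min_degree (cut_size E)"
  define X where "X = hits E h"
  define Y where "Y = (\<lambda>v. {u \<in> X v. (u \<in> S) = (v \<in> S)})"
  define Z where "Z = (\<lambda>v. {u \<in> X v. (u \<in> S) \<noteq> (v \<in> S)})"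
  have kap_pos: "1 \<le> kap" using L_pos by (simp add: kap_def)
  have XV: "X v \<subseteq> V" for v using nbrs_subset[OF G] by (auto simp: X_def hits_def)
  have finX: "finite (X v)" for v using XV finV finite_subset by blast
  have X8: "card (X v) \<le> 8 * kap" and Y5: "5 * L \<le> card (Y v)" if "v \<in> V" for v
    using h that by (auto simp: good_hash_def X_def Y_def)
  have YX: "Y v \<subseteq> X v" for v by (auto simp: Y_def)
  have XYZ: "card (X v) = card (Y v) + card (Z v)" for v
  proof -
    have "card (Y v \<union> Z v) = card (Y v) + card (Z v)"
      using finX by (intro card_Un_disjoint) (auto simp: Y_def Z_def)
    moreover have "Y v \<union> Z v = X v" by (auto simp: Y_def Z_def)
    ultimately show ?thesis by simp
  qed
  have sumZ: "(\<Sum>v\<in>V. card (Z v)) \<le> 32 * kap"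
  proof -
    have "(SIGMA v:V. Z v) = {(v, u) \<in> crossing (\<lambda>v. v \<in> S) (edge_arcs E). u \<in> hits E h v}"
      using edge_arcs_subset[OF G] by (auto simp: Z_def X_def crossing_def edge_arcs_def hits_def)
    then show ?thesis using h finV finX by (simp add: good_hash_def card_SigmaI[symmetric] Z_def)
  qed
  have L0: "0 < real L" using L_pos by simp
  have "exp (- 16384) \<le> (\<Prod>v\<in>V. exp (- (64 * (real (card (Z v)) / (5 * real L)))))"
  proof -
    have "(\<Sum>v\<in>V. 64 * (real (card (Z v)) / (5 * real L))) = 64 / (5 * real L) * real (\<Sum>v\<in>V. card (Z v))"
      by (simp add: sum_distrib_left)
    also have "\<dots> \<le> 64 / (5 * real L) * real (32 * kap)"
      using sumZ L0 by (intro mult_left_mono) (auto simp only: of_nat_le_iff, auto)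
    also have "\<dots> = 16384" using L0 by (simp add: kap_def)
    finally have "- 16384 \<le> (\<Sum>v\<in>V. - (64 * (real (card (Z v)) / (5 * real L))))"
      by (simp add: sum_negf)
    then show ?thesis using finV by (simp add: exp_sum[symmetric])
  qed
  also have "\<dots> \<le> (\<Prod>v\<in>V. real (card (Y v)) / real (card (X v)))"
  proof (intro prod_mono conjI)
    fix v assume v: "v \<in> V"
    define y where "y = real (card (Y v)) / real (card (X v))"
    have Y0: "0 < real (card (Y v))" "5 * real L \<le> real (card (Y v))" using Y5[OF v] L_pos by auto
    have X0: "0 < real (card (X v))" using XYZ[of v] Y0 by simp
    define w where "w = real (card (Z v)) / (5 * real L)"
    have y: "1 / 64 \<le> y"
    proof -
      have "real (card (X v)) \<le> 320 * real L" using X8[OF v] by (simp add: kap_def)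
      also have "\<dots> \<le> 64 * real (card (Y v))" using Y0(2) by simp
      finally show ?thesis using X0 by (simp add: y_def field_simps)
    qed
    have y1: "y \<le> 1" using X0 XYZ[of v] by (simp add: y_def)
    have "1 - y = real (card (Z v)) / real (card (X v))"
      using X0 XYZ[of v] by (simp add: y_def field_simps)
    also have "\<dots> \<le> w" unfolding w_def
      using Y0 XYZ[of v] L0 by (intro divide_left_mono) auto
    finally have "- (64 * w) \<le> - (64 * (1 - y))" by simp
    then have "exp (- (64 * w)) \<le> exp (- (64 * (1 - y)))" by (simp only: exp_le_cancel_iff)
    also have "\<dots> \<le> y" by (rule exp_le_of_ge[OF y y1])
    finally show "exp (- (64 * (real (card (Z v)) / (5 * real L)))) \<le> real (card (Y v)) / real (card (X v))"
      unfolding y_def[symmetric] w_def[symmetric] .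
  qed auto
  also have "\<dots> = ?P {g. \<forall>v\<in>V. g (v, X v) \<in> Y v}"
  proof (rule prob_choices[symmetric])
    fix v assume "v \<in> V"
    then have "card (X v) \<noteq> 0" using Y5[of v] XYZ[of v] L_pos by simp
    then show "X v \<subseteq> V \<and> X v \<noteq> {}" using XV by auto
  qed (rule YX)
  also have "\<dots> \<le> ?P {g. good_star E S (star h g (cut_size E))}"
  proof (rule measure_pmf.finite_measure_mono)
    show "{g. \<forall>v\<in>V. g (v, X v) \<in> Y v} \<subseteq> {g. good_star E S (star h g (cut_size E))}"
    proof
      fix g assume "g \<in> {g. \<forall>v\<in>V. g (v, X v) \<in> Y v}"
      then have g: "g (v, X v) \<in> Y v" if "v \<in> V" for v using that by blast
      define s where "s = star h g (cut_size E)"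
      have s: "s v = g (v, X v)" if v: "v \<in> V" for v
      proof -
        have "recover (cut_size E) v (centers h (cut_size E) v) (8 * kap) = hits E h v"
          unfolding hits_eq[OF G, symmetric]
          using X8[OF v] hits_eq[OF G, of v h]
          by (intro recover_correct[OF G centers_subset v]) (auto simp: X_def centers_def)
        then show ?thesis using v kap by (simp add: s_def star_def X_def)
      qed
      have side: "(s v \<in> S) = (v \<in> S)" if "v \<in> V" for v using g[OF that] s[OF that] by (simp add: Y_def)
      have "coarser V s (\<lambda>v. v \<in> S)" unfolding coarser_def using side by metis
      \<comment> \<open>The pick of \<open>v\<close> has a hash value below the threshold for the
        degree of \<open>v\<close>, hence below the one for the minimum degree; this limits the
        number of labels.\<close>
      moreover have "s ` V \<subseteq> {u \<in> V. h u < threshold ?\<delta>}"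
      proof
        fix u assume "u \<in> s ` V"
        then obtain v where v: "v \<in> V" "u = s v" by blast
        have "u \<in> X v" using g[OF v(1)] s[OF v(1)] v(2) YX by auto
        moreover have "threshold (cut_size E {v}) \<le> threshold ?\<delta>"
          using kap kap_pos min_degree_le[OF v(1)] by (intro threshold_antimono) auto
        ultimately show "u \<in> {u \<in> V. h u < threshold ?\<delta>}" using XV[of v] by (auto simp: X_def hits_def)
      qed
      then have "card (s ` V) \<le> card {u \<in> V. h u < threshold ?\<delta>}" using finV by (intro card_mono) auto
      then have "card (s ` V) * ?\<delta> \<le> card {u \<in> V. h u < threshold ?\<delta>} * ?\<delta>" by simp
      with h have "card (s ` V) * ?\<delta> \<le> 16 * kap * n" unfolding good_hash_def by linarith
      ultimately show "g \<in> {g. good_star E S (star h g (cut_size E))}"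
        by (simp add: good_star_def s_def)
    qed
  qed simp
  finally show ?thesis .
qed

definition trial_coins :: "((('a \<Rightarrow> nat) \<times> ('a \<times> 'a set \<Rightarrow> 'a)) \<times> (nat \<times> 'a \<times> 'a \<Rightarrow> bool)) pmf" where
  "trial_coins = pair_pmf (pair_pmf hashes choices) masks"

lemma prob_good_star:
  assumes G: "simple_graph V E" and S: "is_min_cut V E S" and lt: "cut_size E S < min_degree (cut_size E)"
  shows "1 / 2 * exp (- 16384)
    \<le> measure_pmf.prob (pair_pmf hashes choices) {(h, g). good_star E S (star h g (cut_size E))}"
proof (cases "kap \<le> min_degree (cut_size E)")
  case True
  have "1 / 2 * exp (- 16384) \<le> measure_pmf.prob (pair_pmf hashes choices)
      {(h, g). h \<in> {h. good_hash E S h} \<and> g \<in> {g. good_star E S (star h g (cut_size E))}}"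
    by (rule prob_pair_pmf_ge) (use prob_good_hash[OF G S lt True] prob_good_choices[OF G _ True] in auto)
  also have "\<dots> \<le> measure_pmf.prob (pair_pmf hashes choices) {(h, g). good_star E S (star h g (cut_size E))}"
    by (rule measure_pmf.finite_measure_mono) auto
  finally show ?thesis .
next
  case False
  have "good_star E S (star h g (cut_size E))" for h g
  proof -
    have s: "star h g (cut_size E) = (\<lambda>v. v)" using False by (auto simp: star_def)
    have "n * min_degree (cut_size E) \<le> n * kap" using False by (intro mult_left_mono) auto
    also have "\<dots> \<le> 16 * kap * n" by simp
    finally have "n * min_degree (cut_size E) \<le> 16 * kap * n" .
    then show ?thesis unfolding good_star_def s by (simp add: coarser_def)
  qed
  then have U: "{(h, g). good_star E S (star h g (cut_size E))} = UNIV" by auto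
  have "exp (- 16384) \<le> (1 :: real)" by simp
  then have "1 / 2 * exp (- 16384) \<le> (1 :: real)" by linarith
  then show ?thesis unfolding U
    using measure_pmf.prob_space[of "pair_pmf hashes choices"] by (simp only: space_measure_pmf)
qed

text \<open>The masks are independent of the star coins, so \<open>prob_good_masks\<close> applies
  to each good star labeling and contributes another factor 1/2.\<close>

lemma prob_trial:
  assumes G: "simple_graph V E" and S: "is_min_cut V E S" and lt: "cut_size E S < min_degree (cut_size E)"
  shows "1 / 4 * exp (- 16384) \<le> measure_pmf.prob trial_coins
    {((h, g), F). is_min_cut V E (candidate h g F (cut_size E))}"
proof -
  let ?c = "cut_size E"
  let ?X = "{(h, g). good_star E S (star h g ?c)}"
  let ?Y = "\<lambda>x. {F. good_masks E S (star (fst x) (snd x) ?c) F}"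
  have "1 / 2 * exp (- 16384) * (1 / 2) \<le> measure_pmf.prob trial_coins {(x, F). x \<in> ?X \<and> F \<in> ?Y x}"
    unfolding trial_coins_def
  proof (rule prob_pair_pmf_ge)
    show "1 / 2 * exp (- 16384) \<le> measure_pmf.prob (pair_pmf hashes choices) ?X"
      by (rule prob_good_star[OF G S lt])
    fix x assume "x \<in> ?X"
    then show "1 / 2 \<le> measure_pmf.prob masks (?Y x)"
      using lt by (intro prob_good_masks[OF G _ refl]) (auto simp: good_star_def)
  qed simp
  also have "\<dots> \<le> measure_pmf.prob trial_coins {((h, g), F). is_min_cut V E (candidate h g F ?c)}"
  proof (rule measure_pmf.finite_measure_mono)
    show "{(x, F). x \<in> ?X \<and> F \<in> ?Y x} \<subseteq> {((h, g), F). is_min_cut V E (candidate h g F ?c)}"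
    proof clarsimp
      fix h g F assume st: "good_star E S (star h g ?c)" and ms: "good_masks E S (star h g ?c) F"
      define s where "s = star h g ?c"
      have m: "card (s ` V) \<le> n" "card (s ` V) * min_degree ?c \<le> 16 * kap * n"
        using st card_image_le[OF finV] by (auto simp: good_star_def s_def)
      show "is_min_cut V E (candidate h g F ?c)"
      proof (rule trial_success[OF G S s_def, where \<theta> = "bound ?c (card (s ` V))"])
        show "coarser V s (\<lambda>v. v \<in> S)" using st by (simp add: good_star_def s_def)
        show "bound ?c (card (s ` V)) (r - 1) \<le> real M" by (rule bound_final[OF m])
        have "card (crossing s (edge_arcs E)) \<le> card (V \<times> V)"
          using edge_arcs_subset[OF G] finV by (intro card_mono) (auto simp: crossing_def)
        then have "real (card (crossing s (edge_arcs E))) \<le> real (n * n)"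
          by (simp only: card_cartesian_product of_nat_le_iff)
        then show "real (card (crossing s (edge_arcs E))) \<le> bound ?c (card (s ` V)) 0"
          by (simp add: bound_def power2_eq_square)
      qed (use ms[folded s_def] in \<open>auto simp: good_masks_def\<close>)
    qed
  qed simp
  finally show ?thesis by simp
qed

end

lemma arg_min_on_cong:
  assumes "\<And>x. x \<in> A \<Longrightarrow> f x = g x"
  shows "arg_min_on f A = arg_min_on g A"
proof -
  have "is_arg_min f (\<lambda>x. x \<in> A) = is_arg_min g (\<lambda>x. x \<in> A)"
    using assms by (auto simp: is_arg_min_def fun_eq_iff)
  then show ?thesis by (simp add: arg_min_on_def arg_min_def)
qed

lemma sum_list_le_length: "(\<And>x. x \<in> set xs \<Longrightarrow> f x \<le> b) \<Longrightarrow> sum_list (map f xs) \<le> length xs * b" for b :: nat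
  by (induction xs) (simp, fastforce)

type_synonym 'a coins = "nat \<Rightarrow> (('a \<Rightarrow> nat) \<times> ('a \<times> 'a set \<Rightarrow> 'a)) \<times> (nat \<times> 'a \<times> 'a \<Rightarrow> bool)"

context cut_setting
begin

section \<open>Amplification by parallel trials\<close>

text \<open>\<open>T\<close> times the success probability of one trial is at least
  \<open>2 * L\<close>, so all trials fail with probability at most \<open>exp (- (2 * L))\<close>,
  which is at most \<open>1 / n ^ 2\<close>.\<close>

definition T :: nat where "T = nat \<lceil>8 * exp 16384 * real L\<rceil>"

definition all_coins :: "'a coins pmf" where
  "all_coins = Pi_pmf {..<T} undefined (\<lambda>_. trial_coins)"

definition nth_queries :: "'a coins \<Rightarrow> nat \<Rightarrow> nat \<Rightarrow> ('a set \<Rightarrow> nat) \<Rightarrow> 'a set list" where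
  "nth_queries \<omega> i = trial_queries (fst (fst (\<omega> i))) (snd (fst (\<omega> i))) (snd (\<omega> i))"

definition nth_candidate :: "'a coins \<Rightarrow> nat \<Rightarrow> ('a set \<Rightarrow> nat) \<Rightarrow> 'a set" where
  "nth_candidate \<omega> i = candidate (fst (fst (\<omega> i))) (snd (fst (\<omega> i))) (snd (\<omega> i))"

definition all_queries :: "'a coins \<Rightarrow> nat \<Rightarrow> ('a set \<Rightarrow> nat) \<Rightarrow> 'a set list" where
  "all_queries \<omega> t c = concat (map (\<lambda>i. nth_queries \<omega> i t c) [0..<T])"

text \<open>The singletons cover the case that some vertex is itself a minimum cut, where nothing is
  claimed about the trials. The filter discards the empty default of
  \<open>candidate\<close>.\<close>

definition all_candidates :: "'a coins \<Rightarrow> ('a set \<Rightarrow> nat) \<Rightarrow> 'a set set" where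
  "all_candidates \<omega> c =
    (\<lambda>v. {v}) ` V \<union> {S \<in> (\<lambda>i. nth_candidate \<omega> i c) ` {..<T}. S \<noteq> {} \<and> S \<subset> V}"

definition best_cut :: "'a coins \<Rightarrow> ('a set \<Rightarrow> nat) \<Rightarrow> 'a set \<times> nat" where
  "best_cut \<omega> c = (let S = arg_min_on c (all_candidates \<omega> c) in (S, c S))"

definition algorithm :: "'a coins \<Rightarrow> 'a cut_alg" where
  "algorithm \<omega> = protocol_alg (all_queries \<omega>) (best_cut \<omega>) (2 * r + 3) 0 (\<lambda>_. 0)"

lemma T_pos: "0 < T"
proof -
  have "0 < 8 * exp 16384 * real L" using L_pos by simp
  then show ?thesis unfolding T_def by linarith
qed

lemma T_ge: "8 * exp 16384 * real L \<le> real T" and T_le: "real T \<le> (8 * exp 16384 + 1) * real L"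
proof -
  have 1: "0 \<le> 8 * exp 16384 * real L" by simp
  then show "8 * exp 16384 * real L \<le> real T" unfolding T_def by linarith
  have "real T \<le> 8 * exp 16384 * real L + 1" using 1 unfolding T_def by linarith
  also have "\<dots> \<le> (8 * exp 16384 + 1) * real L" using L_pos by (simp add: distrib_right)
  finally show "real T \<le> (8 * exp 16384 + 1) * real L" .
qed

lemma agree_nth:
  assumes "agree (all_queries \<omega>) t c c'" "i < T"
  shows "agree (nth_queries \<omega> i) t c c'"
  using assms unfolding agree_def all_queries_def by fastforce

lemma causal_all_queries:
  assumes "t < 2 * r + 3"
  shows "causal (all_queries \<omega>) t (all_queries \<omega> t)"
  unfolding causal_def
proof (intro allI impI)
  fix c c' assume ag: "agree (all_queries \<omega>) t c c'"
  have "nth_queries \<omega> i t c = nth_queries \<omega> i t c'" if "i < T" for i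
    using causalD[OF causal_trial_queries, of t] agree_nth[OF ag that] assms
    unfolding nth_queries_def by simp
  then show "all_queries \<omega> t c = all_queries \<omega> t c'"
    unfolding all_queries_def by (intro arg_cong[where f = concat] map_cong) auto
qed

lemma singleton_psubset: "v \<in> V \<Longrightarrow> {v} \<subset> V"
  using n_ge_2 by (metis card.empty card_insert_disjoint empty_iff finite.emptyI insert_subset
      le_numeral_extra(4) lessI not_less numeral_2_eq_2 psubsetI subset_empty empty_subsetI)

lemma all_candidates:
  "finite (all_candidates \<omega> c)" "all_candidates \<omega> c \<noteq> {}"
  "S \<in> all_candidates \<omega> c \<Longrightarrow> S \<noteq> {} \<and> S \<subset> V"
  using finV V_nonempty singleton_psubset by (auto simp: all_candidates_def)

text \<open>Every candidate has had its value queried: singletons in round 0, the outcomes of the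
  trials in the last round.\<close>

lemma causal_best_cut: "causal (all_queries \<omega>) (2 * r + 3) (best_cut \<omega>)"
  unfolding causal_def
proof (intro allI impI)
  fix c c' assume ag: "agree (all_queries \<omega>) (2 * r + 3) c c'"
  have cand: "nth_candidate \<omega> i c = nth_candidate \<omega> i c'" "c (nth_candidate \<omega> i c) = c' (nth_candidate \<omega> i c)"
    if i: "i < T" for i
  proof -
    note ag_i = agree_nth[OF ag i]
    show "nth_candidate \<omega> i c = nth_candidate \<omega> i c'" unfolding nth_candidate_def
      by (rule agree_candidate) (use agree_mono[OF ag_i, of "2 * r + 2"] in \<open>simp add: nth_queries_def\<close>)
    show "c (nth_candidate \<omega> i c) = c' (nth_candidate \<omega> i c)"
      by (rule agreeD[OF ag_i, of "2 * r + 2"]) (auto simp: nth_queries_def trial_queries_def nth_candidate_def)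
  qed
  \<comment> \<open>Singletons are queried only within trials, so at least one trial must
    exist.\<close>
  have single: "c {v} = c' {v}" if "v \<in> V" for v
    using agree_singleton[OF agree_nth[OF ag T_pos, unfolded nth_queries_def] _ that] by simp
  have eq: "all_candidates \<omega> c = all_candidates \<omega> c'"
    unfolding all_candidates_def using cand(1) by (intro arg_cong2[where f = "(\<union>)"] refl) (auto simp: image_iff)
  have val: "c S = c' S" if "S \<in> all_candidates \<omega> c" for S
    using that cand(2) single by (auto simp: all_candidates_def)
  have "arg_min_on c (all_candidates \<omega> c) = arg_min_on c' (all_candidates \<omega> c')"
    unfolding eq[symmetric] by (rule arg_min_on_cong) (rule val)
  moreover have "arg_min_on c (all_candidates \<omega> c) \<in> all_candidates \<omega> c"
    by (rule arg_min_if_finite(1)[OF all_candidates(1,2)])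
  ultimately show "best_cut \<omega> c = best_cut \<omega> c'" using val by (simp add: best_cut_def Let_def)
qed

section \<open>Cost and correctness of the combined algorithm\<close>

lemma algorithm_run:
  "queries_by_round c (algorithm \<omega>) = map (\<lambda>t. all_queries \<omega> t c) [0..<2 * r + 3]"
  "alg_output c (algorithm \<omega>) = best_cut \<omega> c"
  using protocol_alg_correct[OF causal_all_queries causal_best_cut, of 0 "2 * r + 3" \<omega> c "\<lambda>_. 0"]
  by (auto simp: algorithm_def agree_def)

lemma algorithm_legal: "legal_queries V E (algorithm \<omega>)"
  using trial_queries_subset
  by (fastforce simp: legal_queries_def algorithm_run all_queries_def nth_queries_def)

lemma algorithm_rounds: "num_rounds E (algorithm \<omega>) = 2 * r + 3"
  by (simp add: num_rounds_def algorithm_run)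

lemma algorithm_queries:
  "num_queries E (algorithm \<omega>) \<le> (2 * r + 3) * (T * (48 * L * kap * n + 12 * n + 6 * L * M))"
proof -
  have "length (all_queries \<omega> t (cut_size E)) \<le> T * (48 * L * kap * n + 12 * n + 6 * L * M)" for t
    unfolding all_queries_def nth_queries_def length_concat map_map o_def
    using sum_list_le_length[of "[0..<T]", OF length_trial_queries] by simp
  then show ?thesis
    unfolding num_queries_def algorithm_run length_concat map_map o_def
    using sum_list_le_length[of "[0..<2 * r + 3]" "\<lambda>t. length (all_queries \<omega> t (cut_size E))"] by simp
qed

lemma algorithm_correct:
  assumes S: "S \<in> all_candidates \<omega> (cut_size E)" "is_min_cut V E S"
  shows "finds_min_cut V E (algorithm \<omega>)"
proof -
  let ?c = "cut_size E"
  define U where "U = arg_min_on ?c (all_candidates \<omega> ?c)"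
  have U: "U \<in> all_candidates \<omega> ?c" unfolding U_def
    by (rule arg_min_if_finite(1)[OF all_candidates(1,2)])
  have "?c U \<le> ?c S" unfolding U_def
    using arg_min_if_finite(2)[OF all_candidates(1,2)[of \<omega> ?c], of ?c] S(1) by (meson not_less)
  from order_trans[OF this] have "is_min_cut V E U"
    using all_candidates(3)[OF U] S(2) by (simp add: is_min_cut_def)
  then show ?thesis by (auto simp: finds_min_cut_def algorithm_run best_cut_def Let_def U_def)
qed

lemma min_cut_exists: "\<exists>S. is_min_cut V E S"
proof -
  let ?A = "{S. S \<noteq> {} \<and> S \<subset> V}"
  have A: "finite ?A" "?A \<noteq> {}"
    using finV V_nonempty singleton_psubset by (auto intro: finite_subset[of _ "Pow V"])
  have "is_min_cut V E (arg_min_on (cut_size E) ?A)"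
    using arg_min_if_finite(1)[OF A, of "cut_size E"] arg_min_if_finite(2)[OF A, of "cut_size E"]
    by (auto simp: is_min_cut_def not_less)
  then show ?thesis by blast
qed

lemma prob_algorithm:
  assumes G: "simple_graph V E"
  shows "1 - 1 / real n ^ 2 \<le> measure_pmf.prob all_coins {\<omega>. finds_min_cut V E (algorithm \<omega>)}"
proof -
  let ?c = "cut_size E" and ?P = "measure_pmf.prob all_coins"
  obtain S where S: "is_min_cut V E S" using min_cut_exists by blast
  show ?thesis
  proof (cases "?c S < min_degree ?c")
    \<comment> \<open>Some vertex attains the minimum cut, and success is certain.\<close>
    case False
    have "min_degree ?c \<in> (\<lambda>v. ?c {v}) ` V"
      unfolding min_degree_def using finV V_nonempty by (intro Min_in) auto
    then obtain v where v: "v \<in> V" "?c {v} \<le> ?c S" using False by auto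
    from order_trans[OF v(2)] have "is_min_cut V E {v}"
      using S singleton_psubset[OF v(1)] by (simp add: is_min_cut_def)
    then have "finds_min_cut V E (algorithm \<omega>)" for \<omega>
      using v(1) by (intro algorithm_correct) (auto simp: all_candidates_def)
    then have U: "{\<omega>. finds_min_cut V E (algorithm \<omega>)} = UNIV" by auto
    have "1 - 1 / real n ^ 2 \<le> 1" by simp
    then show ?thesis unfolding U
      using measure_pmf.prob_space[of all_coins] by (simp only: space_measure_pmf)
  next
    case True
    define good where "good = {((h, g), F). is_min_cut V E (candidate h g F ?c)}"
    define \<sigma> :: real where "\<sigma> = 1 / 4 * exp (- 16384)"
    have good: "\<sigma> \<le> measure_pmf.prob trial_coins good"
      unfolding \<sigma>_def good_def by (rule prob_trial[OF G S True])
    have bad: "measure_pmf.prob trial_coins (- good) \<le> exp (- \<sigma>)"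
    proof -
      have "measure_pmf.prob trial_coins (- good) = 1 - measure_pmf.prob trial_coins good"
        using measure_pmf.prob_compl[of good trial_coins] by (simp add: Compl_eq_Diff_UNIV)
      then show ?thesis using good exp_ge_add_one_self[of "- \<sigma>"] by linarith
    qed
    \<comment> \<open>A single successful trial suffices, as the output is the best candidate by its
      true value; failure therefore requires all independent trials to fail.\<close>
    have "- {\<omega>. finds_min_cut V E (algorithm \<omega>)} \<subseteq> Pi {..<T} (\<lambda>_. - good)"
    proof (intro subsetI Pi_I)
      fix \<omega> i assume \<omega>: "\<omega> \<in> - {\<omega>. finds_min_cut V E (algorithm \<omega>)}" and i: "i \<in> {..<T}"
      show "\<omega> i \<in> - good"
      proof
        assume "\<omega> i \<in> good"
        then have mc: "is_min_cut V E (nth_candidate \<omega> i ?c)"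
          unfolding nth_candidate_def good_def by (cases "\<omega> i") auto
        then have "nth_candidate \<omega> i ?c \<in> all_candidates \<omega> ?c"
          using i by (auto simp: all_candidates_def is_min_cut_def)
        then show False using algorithm_correct mc \<omega> by blast
      qed
    qed
    then have "?P (- {\<omega>. finds_min_cut V E (algorithm \<omega>)}) \<le> ?P (Pi {..<T} (\<lambda>_. - good))"
      by (intro measure_pmf.finite_measure_mono) auto
    also have "\<dots> = measure_pmf.prob trial_coins (- good) ^ T"
      unfolding all_coins_def by (subst measure_Pi_pmf_Pi) auto
    also have "\<dots> \<le> exp (- \<sigma>) ^ T" using bad by (intro power_mono) auto
    also have "\<dots> = exp (- (real T * \<sigma>))" by (simp add: exp_of_nat_mult[symmetric])
    also have "\<dots> \<le> exp (- (2 * real L))"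
    proof -
      have "exp (16384 :: real) * exp (- 16384) = 1" by (simp add: exp_add[symmetric])
      then have "2 * real L = 8 * exp 16384 * real L * \<sigma>" by (simp add: \<sigma>_def)
      also have "\<dots> \<le> real T * \<sigma>" using T_ge by (intro mult_right_mono) (auto simp: \<sigma>_def)
      finally show ?thesis by simp
    qed
    also have "\<dots> \<le> 2 powr (- (2 * real L))" by (rule exp_minus_le_2_powr) simp
    also have "\<dots> = 1 / (2 ^ L) ^ 2"
      unfolding powr_minus using powr_realpow[of 2 "2 * L"]
      by (simp add: inverse_eq_divide power_mult[symmetric] mult.commute)
    also have "\<dots> \<le> 1 / real n ^ 2"
    proof -
      have "real n \<le> real (2 ^ L)" using n_le_pow by (simp only: of_nat_le_iff)
      then have "real n ^ 2 \<le> (2 ^ L) ^ 2" by (intro power_mono) auto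
      then show ?thesis using n_ge_2 by (intro divide_left_mono) auto
    qed
    finally show ?thesis by (rule prob_ge_one_minus)
  qed
qed

text \<open>One logarithm stems from \<open>T\<close> and two from the queries of a round. The
  constants are 301938 = 1920 + 12 + 300006, and 40 = 5 * 2 ^ 3 from
  \<open>2 * r + 3 \<le> 5 * r\<close> and \<open>L \<le> 2 * log 2 n\<close>.\<close>

lemma queries_bound:
  "real ((2 * r + 3) * (T * (48 * L * kap * n + 12 * n + 6 * L * M)))
    \<le> 40 * 301938 * (8 * exp 16384 + 1) * log 2 (real n) ^ 3 * (real r * real n powr (1 + 1 / real r))"
proof -
  define e :: real where "e = 8 * exp 16384 + 1"
  have e: "0 < e" by (simp add: e_def add_pos_pos)
  define y where "y = real L ^ 2 * real n * q"
  have nq: "1 \<le> real n * q" "0 \<le> real n" using n_ge_2 q_ge_1 mult_mono[of 1 "real n" 1 q] by auto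
  have L1: "1 \<le> real L" using L_pos by simp
  have L2: "real L \<le> 2 * log 2 (real n)"
  proof -
    have "1 \<le> log 2 (real n)" using r_pos r_le_log by linarith
    then show ?thesis unfolding L_def by linarith
  qed
  have M: "real M \<le> 50001 * (real L * real n * q)"
  proof -
    have "1 * 1 \<le> real L * (real n * q)" using L1 nq by (intro mult_mono) auto
    then have "1 \<le> real L * real n * q" by (simp add: mult.assoc)
    moreover have "real M \<le> 50000 * (real L * real n * q) + 1"
      unfolding M_def mult.assoc using q_ge_1 by (simp add: of_nat_nat)
    ultimately show ?thesis by linarith
  qed
  have "real (48 * L * kap * n + 12 * n + 6 * L * M) \<le> 301938 * y"
  proof -
    have a: "real L ^ 2 * real n \<le> y"
      unfolding y_def using q_ge_1 mult_left_mono[of 1 q "real L ^ 2 * real n"] by simp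
    have b: "real n \<le> real L ^ 2 * real n"
      using L1 mult_right_mono[of 1 "real L ^ 2" "real n"] by simp
    have "6 * real L * real M \<le> 6 * real L * (50001 * (real L * real n * q))"
      using M by (intro mult_left_mono) auto
    also have "\<dots> = 300006 * y" by (simp add: y_def power2_eq_square)
    finally have c: "6 * real L * real M \<le> 300006 * y" .
    have "real (48 * L * kap * n + 12 * n + 6 * L * M)
        = 1920 * (real L ^ 2 * real n) + 12 * real n + 6 * real L * real M"
      by (simp add: kap_def power2_eq_square)
    with a b c show ?thesis by linarith
  qed
  moreover have "real (2 * r + 3) \<le> 5 * real r" using r_pos by simp
  ultimately have "real ((2 * r + 3) * (T * (48 * L * kap * n + 12 * n + 6 * L * M)))
      \<le> (5 * real r) * (e * real L * (301938 * y))"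
    unfolding of_nat_mult[of "2 * r + 3"] of_nat_mult[of T] using T_le[folded e_def] e
    by (intro mult_mono) auto
  also have "\<dots> = 5 * 301938 * e * (real L ^ 3 * (real r * (real n * q)))"
    by (simp add: y_def power2_eq_square power3_eq_cube mult_ac)
  also have "\<dots> \<le> 5 * 301938 * e * ((2 * log 2 (real n)) ^ 3 * (real r * (real n * q)))"
    using L2 nq q_ge_1 e by (intro mult_left_mono mult_right_mono power_mono) auto
  also have "real n * q = real n powr (1 + 1 / real r)"
    using n_ge_2 by (simp add: q_def powr_add)
  finally show ?thesis unfolding e_def[symmetric] by (simp add: power_mult_distrib mult_ac)
qed

end

theorem mainTheorem6:
  shows "\<exists>(C::real) (k::nat). C > 0 \<and>
    (\<forall>(V :: 'a set) (n::nat) (r::nat).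
       finite V \<and> card V = n \<and> 1 \<le> r \<and> real r \<le> log 2 (real n) \<longrightarrow>
       (\<exists>\<A> :: 'a cut_alg pmf.
          \<forall>E. simple_graph V E \<longrightarrow>
            (\<forall>A \<in> set_pmf \<A>.
               legal_queries V E A \<and>
               num_rounds E A \<le> 3 * r + 4 \<and>
               real (num_queries E A)
                 \<le> C * log 2 (real n) ^ k * (real r * real n powr (1 + 1 / real r))) \<and>
            measure_pmf.prob \<A> {A. finds_min_cut V E A} \<ge> 1 - 1 / real n ^ 2))"
proof (intro exI conjI allI impI)
  show "0 < 40 * 301938 * (8 * exp 16384 + 1 :: real)" by (simp add: add_pos_pos)
  fix V :: "'a set" and n r :: nat
  assume asm: "finite V \<and> card V = n \<and> 1 \<le> r \<and> real r \<le> log 2 (real n)"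
  then interpret cut_setting V r by unfold_locales auto
  have n: "card V = n" using asm by simp
  fix E assume G: "simple_graph V E"
  \<comment> \<open>The distribution depends on \<open>V\<close> and \<open>r\<close> but not on
    \<open>E\<close>. Legality and cost hold for every outcome of the coins; only correctness is
    probabilistic.\<close>
  show "\<forall>A \<in> set_pmf (map_pmf algorithm all_coins). legal_queries V E A \<and> num_rounds E A \<le> 3 * r + 4 \<and>
      real (num_queries E A) \<le> 40 * 301938 * (8 * exp 16384 + 1) * log 2 (real n) ^ 3
        * (real r * real n powr (1 + 1 / real r))"
  proof
    fix A assume "A \<in> set_pmf (map_pmf algorithm all_coins)"
    then obtain \<omega> where A: "A = algorithm \<omega>" by auto
    have "real (num_queries E A) \<le> real ((2 * r + 3) * (T * (48 * L * kap * card V + 12 * card V + 6 * L * M)))"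
      unfolding A of_nat_le_iff by (rule algorithm_queries)
    also note queries_bound
    finally show "legal_queries V E A \<and> num_rounds E A \<le> 3 * r + 4 \<and>
      real (num_queries E A) \<le> 40 * 301938 * (8 * exp 16384 + 1) * log 2 (real n) ^ 3
        * (real r * real n powr (1 + 1 / real r))"
      using algorithm_legal algorithm_rounds unfolding A n by simp
  qed
  show "1 - 1 / real n ^ 2 \<le> measure_pmf.prob (map_pmf algorithm all_coins) {A. finds_min_cut V E A}"
    using prob_algorithm[OF G] unfolding n by (simp add: vimage_def)
qed

end
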